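(* Fix a time step $n\ge 1$. Assume that for each $\ell\in\{1,2\}$: (i) $k_\ell:[0,1]\to[m_{k_\ell},M_{k_\ell}]$ is Lipschitz continuous with $0<m_{k_\ell}\le M_{k_\ell}<\infty$; consequently $k_\ell^{-1}:=1/k_\ell:[0,1]\to[m_{\bar k_\ell},M_{\bar k_\ell}]$ is Lipschitz continuous with $0<m_{\bar k_\ell}\le M_{\bar k_\ell}<\infty$ and Lipschitz constant $L_{\bar k_\ell}$; (ii) $S_\ell:\mathbb{R}\to[0,1]$ is monotonically increasing and Lipschitz continuous with Lipschitz constant $L_{S_\ell}$; (iii) the solution $(\mathbf{q}^n,p^n,g^n)\in Q\times P\times G$ of the limit problem satisfies $\lVert \mathbf{q}^n_\ell\rVert_{L^\infty(\Omega_\ell)}\le M_{\mathbf{q}_\ell}<\infty$. Let $(\mathbf{q}^i,p^i,g^i)_{i\ge 1}$ be generated by the iterative scheme from arbitrary $(\mathbf{q}^0,p^0,g^0)\in Q\times P\times G$. If for each $\ell\in\{1,2\}$ (a) $L_\ell>\tfrac12 L_{S_\ell}$, (b) $\alpha>0$, (c) $\tau<\Bigl(\dfrac{1}{L_{S_\ell}}-\dfrac{1}{2L_\ell}\Bigr)\dfrac{2m_{\bar k_\ell}}{L_{\bar k_\ell}^2M_{\mathbf{q}_\ell}^2}$, then the flux $\mathbf{q}^i$ and the saturation $S^i$ converge strongly to $\mathbf{q}^n$ and $S^n$, respectively, in $L^2(\Omega)$: $$\lim_{i\to\infty}\lVert \mathbf{q}^n-\mathbf{q}^i\rVert=0\qquad\text{and}\qquad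 \lim_{i\to\infty}\lVert S^n-S^i\rVert=0 .$$
   Context: Geometry. $\Omega\subset\mathbb{R}^d$, $d\in\{2,3\}$, is an open bounded domain with Lipschitz boundary partitioned into a Dirichlet part $\partial\Omega_D$ and a Neumann part $\partial\Omega_N$ ($\partial\Omega=\overline{\partial\Omega}_D\cup\overline{\partial\Omega}_N$, $\partial\Omega_D\cap\partial\Omega_N=\emptyset$). $\Omega$ is partitioned into two non-overlapping Lipschitz subdomains, $\overline\Omega=\overline\Omega_1\cup\overline\Omega_2$, $\Omega_1\cap\Omega_2=\emptyset$, with interface $\Gamma:=\partial\Omega_1\cap\partial\Omega_2$, a $(d-1)$-dimensional manifold. Each subdomain borders part of the Dirichlet boundary: $\partial\Omega_\ell\cap\partial\Omega_D\neq\emptyset$ (understood as having positive $(d-1)$-dimensional measure), $\ell\in\{1,2\}$. $\mathbf{n}_\ell$ is the outward unit normal on $\partial\Omega_\ell$, so $\mathbf{n}_1=-\mathbf{n}_2$ on $\Gamma$. Spaces. $\langle\cdot,\cdot\rangle_X$ is the $L^2(X)$ inner product. $$Q_\ell:=\{\tilde{\mathbf{q}}_\ell\in H(\mathrm{div};\Omega_\ell)\mid (\tilde{\mathbf{q}}_\ell\cdot\mathbf{n}_\ell)|_\Gamma\in L^2(\Gamma),\ (\tilde{\mathbf{q}}_\ell\cdot\mathbf{n}_\ell)|_{\partial\Omega_N\cap\partial\Omega_\ell}=0\},\qquad P_\ell:=L^2(\Omega_\ell),$$ $Q:=Q_1\times Q_2$, $P:=P_1\times P_2$, $G:=[L^2(\Gamma)]^2$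 with $\lVert g\rVert_G^2:=\sum_{\ell=1}^2\lVert g_\ell\rVert_{L^2(\Gamma)}^2$. A quantity without subscript $\ell$ denotes the pair of its subdomain restrictions, and $\lVert u\rVert^2:=\sum_{\ell=1}^2\lVert u_\ell\rVert^2_{L^2(\Omega_\ell)}$. Data. $\tau>0$ (time step), $\alpha>0$ (Robin parameter), $L_\ell>0$ (stabilization parameters), $\mathcal{F}_\ell\in L^2(\Omega_\ell)$, $\nabla\eta_\ell\in[L^2(\Omega_\ell)]^d$, and $S_\ell^{n-1}:=S_\ell(p_\ell^{n-1})$ with $p^{n-1}\in P$ given (the previous time step). $k_\ell$ is the permeability and $S_\ell$ the saturation function. The Lipschitz constants and bounds appearing in denominators are taken positive. Limit problem. Find $\mathbf{q}^n\in Q$, $p^n\in P$, $g^n\in G$ such that, with $S_\ell^n:=S_\ell(p_\ell^n)$, $\bar k_\ell^n:=k_\ell^{-1}(S_\ell(p_\ell^n))$, for all $\tilde{\mathbf{q}}\in Q$, $\tilde p\in P$, $\tilde g\in G$ and $\ell,j\in\{1,2\}$, $\ell\ne j$, $$\langle\bar k_\ell^n\mathbf{q}_\ell^n,\tilde{\mathbf{q}}_\ell\rangle_{\Omega_\ell}-\langle p_\ell^n,\nabla\cdot\tilde{\mathbf{q}}_\ell\rangle_{\Omega_\ell}+\alpha\langle\mathbf{q}_\ell^n\cdot\mathbf{n}_\ell,\tilde{\mathbf{q}}_\ell\cdot\mathbf{n}_\ell\rangle_\Gamma=\langle\nabla\eta_\ell,\tilde{\mathbf{q}}_\ell\rangle_{\Omega_\ell}-\langle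 g_\ell^n,\tilde{\mathbf{q}}_\ell\cdot\mathbf{n}_\ell\rangle_\Gamma,$$ $$\langle S_\ell^n,\tilde p_\ell\rangle_{\Omega_\ell}+\tau\langle\nabla\cdot\mathbf{q}_\ell^n,\tilde p_\ell\rangle_{\Omega_\ell}=\tau\langle\mathcal{F}_\ell,\tilde p_\ell\rangle_{\Omega_\ell}+\langle S_\ell^{n-1},\tilde p_\ell\rangle_{\Omega_\ell},$$ $$\langle g_\ell^n,\tilde g_\ell\rangle_\Gamma=\langle 2\alpha\,\mathbf{q}_j^n\cdot\mathbf{n}_j+g_j^n,\tilde g_\ell\rangle_\Gamma.$$ This problem is taken to have a (unique) solution. Iterative scheme (the index $n$ is dropped on iterates). For $i\ge1$, given $(\mathbf{q}^{i-1},p^{i-1},g^{i-1})\in Q\times P\times G$, set $S_\ell^{i-1}:=S_\ell(p_\ell^{i-1})$, $\bar k_\ell^{i-1}:=k_\ell^{-1}(S_\ell(p_\ell^{i-1}))$; compute $g^i\in G$ from $$\langle g_\ell^i,\tilde g_\ell\rangle_\Gamma=\langle2\alpha\,\mathbf{q}_j^{i-1}\cdot\mathbf{n}_j+g_j^{i-1},\tilde g_\ell\rangle_\Gamma\quad(\ell\neq j)\ \text{ for all }\tilde g\in G,$$ and then find $\mathbf{q}^i\in Q$, $p^i\in P$ such that for all $\tilde{\mathbf{q}}\in Q$, $\tilde p\in P$, $\ell\in\{1,2\}$, $$\langle\bar k_\ell^{i-1}\mathbf{q}_\ell^i,\tilde{\mathbf{q}}_\ell\rangle_{\Omega_\ell}-\langle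 p_\ell^i,\nabla\cdot\tilde{\mathbf{q}}_\ell\rangle_{\Omega_\ell}+\alpha\langle\mathbf{q}_\ell^i\cdot\mathbf{n}_\ell,\tilde{\mathbf{q}}_\ell\cdot\mathbf{n}_\ell\rangle_\Gamma=\langle\nabla\eta_\ell,\tilde{\mathbf{q}}_\ell\rangle_{\Omega_\ell}-\langle g_\ell^i,\tilde{\mathbf{q}}_\ell\cdot\mathbf{n}_\ell\rangle_\Gamma,$$ $$L_\ell\langle p_\ell^i,\tilde p_\ell\rangle_{\Omega_\ell}+\tau\langle\nabla\cdot\mathbf{q}_\ell^i,\tilde p_\ell\rangle_{\Omega_\ell}=\tau\langle\mathcal{F}_\ell,\tilde p_\ell\rangle_{\Omega_\ell}-\langle S_\ell^{i-1}-S_\ell^{n-1},\tilde p_\ell\rangle_{\Omega_\ell}+L_\ell\langle p_\ell^{i-1},\tilde p_\ell\rangle_{\Omega_\ell}.$$ Each step of the scheme is well-posed. *)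

theory Defs
  imports "HOL-Analysis.Analysis" "HOL-Probability.Essential_Supremum"
begin

section \<open>Hausdorff measure\<close>

text \<open>
  The surface measure on hypersurfaces of a Euclidean space of dimension \<open>d\<close> is the
  \<open>(d - 1)\<close>-dimensional Hausdorff measure, normalised by the volume of the unit ball so that it
  agrees with Lebesgue measure on flat pieces.  Only dimensions \<open>s > 0\<close> are intended.
\<close>

definition hausdorff_pre :: "nat \<Rightarrow> real \<Rightarrow> 'a::metric_space set \<Rightarrow> ennreal" where
  "hausdorff_pre s \<delta> A =
     (INF C \<in> {C :: nat \<Rightarrow> 'a set. (\<forall>j. bounded (C j) \<and> diameter (C j) \<le> \<delta>) \<and> A \<subseteq> (\<Union>j. C j)}.
        \<Sum>j. ennreal (unit_ball_vol (real s) * (diameter (C j) / 2) ^ s))"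

definition hausdorff_outer :: "nat \<Rightarrow> 'a::metric_space set \<Rightarrow> ennreal" where
  "hausdorff_outer s A = (SUP \<delta> \<in> {0<..}. hausdorff_pre s \<delta> A)"

definition hausdorff_measure :: "nat \<Rightarrow> 'a::metric_space measure" where
  "hausdorff_measure s = measure_of UNIV (sets borel) (hausdorff_outer s)"

text \<open>
  The outer measure is additive on sets at positive distance, so Borel sets are measurable for it
  and \<open>measure_of\<close> above does not collapse to the zero measure
  (lemma \<open>emeasure_hausdorff_measure\<close>).
\<close>

lemma hausdorff_pre_mono: "A \<subseteq> B \<Longrightarrow> hausdorff_pre s \<delta> A \<le> hausdorff_pre s \<delta> B"
  unfolding hausdorff_pre_def by (rule INF_superset_mono) auto

lemma hausdorff_pre_antimono: "\<delta> \<le> \<delta>' \<Longrightarrow> hausdorff_pre s \<delta>' A \<le> hausdorff_pre s \<delta> A"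
  unfolding hausdorff_pre_def by (rule INF_superset_mono) (auto intro: order_trans)

lemma hausdorff_pre_cover:
  assumes "hausdorff_pre s \<delta> A < c"
  shows "\<exists>C :: nat \<Rightarrow> 'a::metric_space set.
    (\<forall>j. bounded (C j) \<and> diameter (C j) \<le> \<delta>) \<and> A \<subseteq> (\<Union>j. C j) \<and>
    (\<Sum>j. ennreal (unit_ball_vol (real s) * (diameter (C j) / 2) ^ s)) < c"
  using assms unfolding hausdorff_pre_def INF_less_iff by auto

lemma hausdorff_pre_le:
  assumes "\<And>j. bounded (C j)" "\<And>j. diameter (C j) \<le> \<delta>" "A \<subseteq> (\<Union>j::nat. C j)"
  shows "hausdorff_pre s \<delta> A
           \<le> (\<Sum>j. ennreal (unit_ball_vol (real s) * (diameter (C j) / 2) ^ s))"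
  unfolding hausdorff_pre_def using assms by (intro INF_lower) auto

lemma hausdorff_pre_countably_subadditive:
  fixes A :: "nat \<Rightarrow> 'a::metric_space set"
  shows "hausdorff_pre s \<delta> (\<Union>i. A i) \<le> (\<Sum>i. hausdorff_pre s \<delta> (A i))"
proof (rule ennreal_le_epsilon)
  fix e :: real
  assume fin: "(\<Sum>i. hausdorff_pre s \<delta> (A i)) < top" and e: "0 < e"
  define w where "w C = ennreal (unit_ball_vol (real s) * (diameter C / 2) ^ s)" for C :: "'a set"
  have "\<exists>C. (\<forall>j. bounded (C j) \<and> diameter (C j) \<le> \<delta>) \<and> A i \<subseteq> (\<Union>j::nat. C j) \<and>
          (\<Sum>j. w (C j)) \<le> hausdorff_pre s \<delta> (A i) + e * (1/2) ^ Suc i" for i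
  proof -
    have "hausdorff_pre s \<delta> (A i) < top"
      using fin by (metis ennreal_suminf_lessD)
    then have "hausdorff_pre s \<delta> (A i) < hausdorff_pre s \<delta> (A i) + ennreal (e * (1/2) ^ Suc i)"
      using e ennreal_add_left_cancel_less[of "hausdorff_pre s \<delta> (A i)" 0 "ennreal (e * (1/2) ^ Suc i)"]
      by simp
    then obtain C where C: "\<forall>j. bounded (C j) \<and> diameter (C j) \<le> \<delta>" "A i \<subseteq> (\<Union>j. C j)"
        "(\<Sum>j. w (C j)) < hausdorff_pre s \<delta> (A i) + e * (1/2) ^ Suc i"
      using hausdorff_pre_cover[of s \<delta> "A i"] unfolding w_def by blast
    from C(1,2) less_imp_le[OF C(3)] show ?thesis
      by (intro exI[of _ C] conjI)
  qed
  then have "\<forall>i. \<exists>C. (\<forall>j. bounded (C j) \<and> diameter (C j) \<le> \<delta>) \<and> A i \<subseteq> (\<Union>j::nat. C j) \<and>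
          (\<Sum>j. w (C j)) \<le> hausdorff_pre s \<delta> (A i) + e * (1/2) ^ Suc i"
    by (rule allI)
  from choice[OF this]
  obtain C where C: "\<And>i j. bounded (C i j)" "\<And>i j. diameter (C i j) \<le> \<delta>"
      "\<And>i. A i \<subseteq> (\<Union>j::nat. C i j)"
      "\<And>i. (\<Sum>j. w (C i j)) \<le> hausdorff_pre s \<delta> (A i) + e * (1/2) ^ Suc i"
    by blast
  have "hausdorff_pre s \<delta> (\<Union>i. A i) \<le> (\<Sum>n. w (case_prod C (prod_decode n)))"
    unfolding w_def
  proof (rule hausdorff_pre_le)
    show "bounded (case_prod C (prod_decode j))" "diameter (case_prod C (prod_decode j)) \<le> \<delta>" for j
      using C(1,2) by (auto split: prod.split)
    show "(\<Union>i. A i) \<subseteq> (\<Union>n. case_prod C (prod_decode n))"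
    proof
      fix x assume "x \<in> (\<Union>i. A i)"
      then obtain i j where "x \<in> C i j" using C(3) by blast
      then have "x \<in> case_prod C (prod_decode (prod_encode (i, j)))" by simp
      then show "x \<in> (\<Union>n. case_prod C (prod_decode n))"
        by (rule UN_I[OF UNIV_I])
    qed
  qed
  also have "\<dots> = (\<Sum>i. \<Sum>j. w (C i j))"
    using suminf_ennreal_2dimen[of "\<lambda>i. \<Sum>j. w (C i j)" "\<lambda>z. w (case_prod C z)"] by simp
  also have "\<dots> \<le> (\<Sum>i. hausdorff_pre s \<delta> (A i) + ennreal (e * (1/2) ^ Suc i))"
    by (intro suminf_le C(4)) auto
  also have "\<dots> = (\<Sum>i. hausdorff_pre s \<delta> (A i)) + (\<Sum>i. ennreal (e * (1/2) ^ Suc i))"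
    by (intro suminf_add[symmetric]) auto
  also have "(\<Sum>i. ennreal (e * (1/2) ^ Suc i)) = ennreal e"
    using e by (intro suminf_ennreal_eq) (auto intro!: sums_mult[OF power_half_series, simplified])
  finally show "hausdorff_pre s \<delta> (\<Union>i. A i) \<le> (\<Sum>i. hausdorff_pre s \<delta> (A i)) + ennreal e" .
qed

lemma hausdorff_pre_empty: "s > 0 \<Longrightarrow> 0 \<le> \<delta> \<Longrightarrow> hausdorff_pre s \<delta> {} = 0"
  using hausdorff_pre_le[of "\<lambda>_. {}" \<delta> "{}" s] by (simp add: power_0_left)

lemma hausdorff_outer_mono: "A \<subseteq> B \<Longrightarrow> hausdorff_outer s A \<le> hausdorff_outer s B"
  unfolding hausdorff_outer_def by (intro SUP_mono) (blast intro: hausdorff_pre_mono)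

lemma hausdorff_outer_empty: "s > 0 \<Longrightarrow> hausdorff_outer s {} = 0"
  unfolding hausdorff_outer_def by (simp add: hausdorff_pre_empty cong: SUP_cong_simp)

lemma hausdorff_outer_countably_subadditive:
  "hausdorff_outer s (\<Union>i. A i) \<le> (\<Sum>i::nat. hausdorff_outer s (A i))"
  unfolding hausdorff_outer_def
proof (rule SUP_least)
  fix \<delta> :: real assume "\<delta> \<in> {0<..}"
  then show "hausdorff_pre s \<delta> (\<Union>i. A i) \<le> (\<Sum>i. SUP \<delta>\<in>{0<..}. hausdorff_pre s \<delta> (A i))"
    by (intro order_trans[OF hausdorff_pre_countably_subadditive] suminf_le SUP_upper) auto
qed

lemma outer_measure_space_hausdorff:
  "s > 0 \<Longrightarrow> outer_measure_space UNIV (hausdorff_outer s)"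
  unfolding outer_measure_space_def positive_def increasing_def countably_subadditive_def
  by (auto simp: hausdorff_outer_empty hausdorff_outer_mono hausdorff_outer_countably_subadditive)

lemma hausdorff_outer_Un:
  assumes "s > 0"
  shows "hausdorff_outer s (A \<union> B) \<le> hausdorff_outer s A + hausdorff_outer s B"
proof -
  have "hausdorff_outer s (\<Union>i. binaryset A B i) \<le> (\<Sum>i. hausdorff_outer s (binaryset A B i))"
    by (rule hausdorff_outer_countably_subadditive)
  then show ?thesis
    by (simp add: UN_binaryset_eq suminf_binaryset_eq hausdorff_outer_empty assms)
qed

lemma hausdorff_outer_separated:
  fixes A B :: "'a::metric_space set"
  assumes "s > 0" "e > 0" and sep: "\<And>x y. x \<in> A \<Longrightarrow> y \<in> B \<Longrightarrow> e \<le> dist x y"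
  shows "hausdorff_outer s A + hausdorff_outer s B \<le> hausdorff_outer s (A \<union> B)"
proof -
  define w where "w C = ennreal (unit_ball_vol (real s) * (diameter C / 2) ^ s)" for C :: "'a set"
  have w0: "w {} = 0" using assms by (simp add: w_def power_0_left)
  have small: "hausdorff_pre s \<delta> A + hausdorff_pre s \<delta> B \<le> hausdorff_pre s \<delta> (A \<union> B)"
    if \<delta>: "0 < \<delta>" "\<delta> < e" for \<delta>
  proof -
    have "hausdorff_pre s \<delta> A + hausdorff_pre s \<delta> B \<le> (\<Sum>j. w (C j))"
      if C: "\<And>j. bounded (C j)" "\<And>j. diameter (C j) \<le> \<delta>" "A \<union> B \<subseteq> (\<Union>j::nat. C j)" for C
    proof -
      define CA where "CA j = (if C j \<inter> A = {} then {} else C j)" for j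
      define CB where "CB j = (if C j \<inter> B = {} then {} else C j)" for j
      have disj: "C j \<inter> A = {} \<or> C j \<inter> B = {}" for j
      proof (rule ccontr)
        assume "\<not> ?thesis"
        then obtain x y where "x \<in> C j" "x \<in> A" "y \<in> C j" "y \<in> B" by blast
        then show False
          using diameter_bounded_bound[OF C(1)[of j], of x y] C(2)[of j] sep[of x y] \<delta> by simp
      qed
      have "hausdorff_pre s \<delta> A \<le> (\<Sum>j. w (CA j))"
        unfolding w_def by (rule hausdorff_pre_le) (use C \<delta> in \<open>auto simp: CA_def, blast\<close>)
      moreover have "hausdorff_pre s \<delta> B \<le> (\<Sum>j. w (CB j))"
        unfolding w_def by (rule hausdorff_pre_le) (use C \<delta> in \<open>auto simp: CB_def, blast\<close>)
      ultimately have "hausdorff_pre s \<delta> A + hausdorff_pre s \<delta> B \<le> (\<Sum>j. w (CA j)) + (\<Sum>j. w (CB j))"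
        by (rule add_mono)
      also have "\<dots> = (\<Sum>j. w (CA j) + w (CB j))" by (intro suminf_add) auto
      also have "\<dots> \<le> (\<Sum>j. w (C j))"
        using disj by (intro suminf_le) (auto simp: CA_def CB_def w0)
      finally show ?thesis .
    qed
    then show ?thesis
      unfolding hausdorff_pre_def[of s \<delta> "A \<union> B"] by (intro INF_greatest) (auto simp: w_def)
  qed
  have lim: "((\<lambda>n. hausdorff_pre s (e / (real n + 2)) X) \<longlonglongrightarrow> hausdorff_outer s X)" for X :: "'a set"
  proof -
    have "incseq (\<lambda>n. hausdorff_pre s (e / (real n + 2)) X)"
      using \<open>e > 0\<close> by (auto intro!: incseq_SucI hausdorff_pre_antimono divide_left_mono)
    moreover have "(SUP n. hausdorff_pre s (e / (real n + 2)) X) = hausdorff_outer s X"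
      unfolding hausdorff_outer_def
    proof (rule antisym)
      show "(SUP n. hausdorff_pre s (e / (real n + 2)) X) \<le> (SUP \<delta>\<in>{0<..}. hausdorff_pre s \<delta> X)"
        using \<open>e > 0\<close> by (intro SUP_least SUP_upper) auto
      show "(SUP \<delta>\<in>{0<..}. hausdorff_pre s \<delta> X) \<le> (SUP n. hausdorff_pre s (e / (real n + 2)) X)"
      proof (rule SUP_mono)
        fix \<delta> :: real assume "\<delta> \<in> {0<..}"
        then have "\<delta> > 0" by simp
        obtain n :: nat where "e / \<delta> \<le> real n" using real_arch_simple by blast
        then have "e / (real n + 2) \<le> \<delta>"
          using \<open>\<delta> > 0\<close> \<open>e > 0\<close> by (simp add: field_simps)
        then show "\<exists>n\<in>UNIV. hausdorff_pre s \<delta> X \<le> hausdorff_pre s (e / (real n + 2)) X"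
          by (blast intro: hausdorff_pre_antimono)
      qed
    qed
    ultimately show ?thesis using LIMSEQ_SUP by metis
  qed
  show ?thesis
  proof (rule LIMSEQ_le[OF tendsto_add[OF lim lim] lim], intro exI allI impI)
    fix n :: nat
    show "hausdorff_pre s (e / (real n + 2)) A + hausdorff_pre s (e / (real n + 2)) B
            \<le> hausdorff_pre s (e / (real n + 2)) (A \<union> B)"
      using \<open>e > 0\<close> by (intro small) (auto simp: field_simps intro: add_pos_nonneg)
  qed
qed

lemma closed_hausdorff_measurable:
  fixes F :: "'a::metric_space set"
  assumes s: "s > 0" and F: "closed F"
  shows "F \<in> lambda_system UNIV UNIV (hausdorff_outer s)"
proof -
  let ?H = "hausdorff_outer s :: 'a set \<Rightarrow> ennreal"
  have main: "?H (X \<inter> F) + ?H (X - F) \<le> ?H X" if "F \<noteq> {}" "?H X < top" for X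
  proof -
    define B where "B n = {x \<in> X - F. inverse (real (Suc n)) \<le> infdist x F}" for n
    define R where "R n = B (Suc n) - B n" for n
    have RX: "R n \<subseteq> X" for n by (auto simp: R_def B_def)
    have sep: "e \<le> dist x y" if "a + e \<le> infdist x F" "infdist y F \<le> a" for x y a e
      using infdist_triangle[of x F y] that by linarith
    have sums: "(\<Sum>k<K. ?H (R (2 * k + c))) \<le> ?H (\<Union>k<K. R (2 * k + c))" for K c :: nat
    proof (induction K)
      case (Suc K)
      show ?case
      proof (cases "K = 0")
        case False
        define a where "a = inverse (real (Suc (2 * K + c)))"
        define e where "e = inverse (real (2 * K + c)) - a"
        have e: "e > 0" using False unfolding e_def a_def diff_gt_0_iff_gt
          by (intro less_imp_inverse_less) auto
        have "e \<le> dist x y" if "x \<in> (\<Union>k<K. R (2 * k + c))" "y \<in> R (2 * K + c)" for x y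
        proof (rule sep)
          obtain k where k: "k < K" "x \<in> R (2 * k + c)" using \<open>x \<in> _\<close> by blast
          then have "inverse (real (Suc (Suc (2 * k + c)))) \<le> infdist x F"
            by (auto simp: R_def B_def)
          moreover have "inverse (real (2 * K + c)) \<le> inverse (real (Suc (Suc (2 * k + c))))"
            using k by (intro le_imp_inverse_le) auto
          ultimately show "a + e \<le> infdist x F" by (simp add: e_def)
          show "infdist y F \<le> a"
            using \<open>y \<in> _\<close> unfolding R_def B_def a_def by auto
        qed
        then have "?H (\<Union>k<K. R (2 * k + c)) + ?H (R (2 * K + c))
                     \<le> ?H ((\<Union>k<K. R (2 * k + c)) \<union> R (2 * K + c))"
          by (rule hausdorff_outer_separated[OF s e])
        then show ?thesis
          using Suc.IH by (simp add: lessThan_Suc Un_commute add.commute)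
             (meson add_left_mono order_trans)
      qed (simp add: lessThan_Suc)
    qed simp
    have sums2: "(\<Sum>k<K. ?H (R (2 * k + c))) \<le> ?H X" for K c :: nat
      using sums RX by (meson UN_least hausdorff_outer_mono order_trans)
    have "(\<Sum>k<n. ?H (R k)) \<le> 2 * ?H X" for n
    proof -
      have "(\<Sum>k<2 * N. ?H (R k)) = (\<Sum>k<N. ?H (R (2 * k + 0))) + (\<Sum>k<N. ?H (R (2 * k + 1)))" for N
        by (induction N) (simp_all add: ac_simps)
      then have "(\<Sum>k<2 * n. ?H (R k)) \<le> ?H X + ?H X"
        by (metis add_mono sums2)
      moreover have "(\<Sum>k<n. ?H (R k)) \<le> (\<Sum>k<2 * n. ?H (R k))"
        by (intro sum_mono2) auto
      ultimately show ?thesis by (simp add: mult_2)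
    qed
    then have "(\<Sum>k. ?H (R k)) \<le> 2 * ?H X"
      by (intro suminf_le_const) auto
    also have "\<dots> < top" using that by (simp add: ennreal_mult_less_top)
    finally have fin: "(\<Sum>k. ?H (R k)) < top" .
    define T where "T n = (\<Sum>k. ?H (R (k + n)))" for n
    have T: "T \<longlonglongrightarrow> 0"
    proof -
      have "T = (\<lambda>n. (\<Sum>k. ?H (R k)) - (\<Sum>k<n. ?H (R k)))"
      proof
        fix n
        have eq: "(\<Sum>k. ?H (R k)) = T n + (\<Sum>k<n. ?H (R k))"
          unfolding T_def by (rule suminf_offset) simp
        with fin have "(\<Sum>k<n. ?H (R k)) \<noteq> top" by (metis ennreal_add_eq_top less_irrefl)
        then show "T n = (\<Sum>k. ?H (R k)) - (\<Sum>k<n. ?H (R k))" using eq by simp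
      qed
      moreover have "(\<lambda>n. (\<Sum>k. ?H (R k)) - (\<Sum>k<n. ?H (R k)))
          \<longlonglongrightarrow> (\<Sum>k. ?H (R k)) - (\<Sum>k. ?H (R k))"
        using fin by (intro tendsto_diff_ennreal_general[OF tendsto_const summable_LIMSEQ]) auto
      ultimately show ?thesis
        using fin by simp
    qed
    have bound: "?H (X \<inter> F) + ?H (X - F) \<le> ?H X + T n" for n
    proof -
      have cover: "X - F \<subseteq> B n \<union> (\<Union>k. R (k + n))"
      proof
        fix x assume x: "x \<in> X - F"
        then have "infdist x F > 0"
          using F that(1) by (simp add: infdist_pos_not_in_closed)
        then obtain m where m: "inverse (real (Suc m)) < infdist x F"
          using reals_Archimedean by blast
        define l where "l = (LEAST m. x \<in> B m)"
        have "x \<in> B m" using m x by (simp add: B_def)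
        then have l: "x \<in> B l" "\<And>j. j < l \<Longrightarrow> x \<notin> B j"
          unfolding l_def by (auto intro: LeastI dest: not_less_Least)
        show "x \<in> B n \<union> (\<Union>k. R (k + n))"
        proof (cases "l \<le> n")
          case True
          then have "inverse (real (Suc n)) \<le> inverse (real (Suc l))"
            by (intro le_imp_inverse_le) auto
          moreover have "inverse (real (Suc l)) \<le> infdist x F"
            using l(1) by (simp only: B_def mem_Collect_eq)
          ultimately have "inverse (real (Suc n)) \<le> infdist x F" by (rule order_trans)
          then have "x \<in> B n" using x by (simp add: B_def)
          then show ?thesis by blast
        next
          case False
          then have "x \<in> R ((l - 1 - n) + n)"
            using l by (auto simp: R_def)
          then show ?thesis by blast
        qed
      qed
      have "?H (X - F) \<le> ?H (B n) + ?H (\<Union>k. R (k + n))"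
        using hausdorff_outer_mono[OF cover] hausdorff_outer_Un[OF s] order_trans by blast
      also have "\<dots> \<le> ?H (B n) + T n"
        unfolding T_def by (intro add_left_mono hausdorff_outer_countably_subadditive)
      finally have 1: "?H (X - F) \<le> ?H (B n) + T n" .
      have "?H (X \<inter> F) + ?H (B n) \<le> ?H (X \<inter> F \<union> B n)"
      proof (rule hausdorff_outer_separated[OF s, of "inverse (real (Suc n))"])
        fix x y assume "x \<in> X \<inter> F" "y \<in> B n"
        then show "inverse (real (Suc n)) \<le> dist x y"
          using infdist_le[of x F y] by (auto simp: B_def dist_commute)
      qed simp
      also have "\<dots> \<le> ?H X" by (intro hausdorff_outer_mono) (auto simp: B_def)
      finally have 2: "?H (X \<inter> F) + ?H (B n) \<le> ?H X" .
      have "?H (X \<inter> F) + ?H (X - F) \<le> ?H (X \<inter> F) + (?H (B n) + T n)"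
        using 1 by (rule add_left_mono)
      also have "\<dots> = (?H (X \<inter> F) + ?H (B n)) + T n" by (simp add: add.assoc)
      also have "\<dots> \<le> ?H X + T n" using 2 by (rule add_right_mono)
      finally show ?thesis .
    qed
    have "(\<lambda>n. ?H X + T n) \<longlonglongrightarrow> ?H X + 0"
      using T by (intro tendsto_add tendsto_const)
    then show ?thesis
      using bound by (intro LIMSEQ_le_const[where X = "\<lambda>n. ?H X + T n"]) auto
  qed
  have "?H (F \<inter> X) + ?H ((UNIV - F) \<inter> X) = ?H X" for X
  proof (rule antisym)
    have "(UNIV - F) \<inter> X = X - F" by blast
    then show "?H (F \<inter> X) + ?H ((UNIV - F) \<inter> X) \<le> ?H X"
      using main[of X] hausdorff_outer_empty[OF s, where 'a='a]
      by (cases "F = {}"; cases "?H X = top") (auto simp: Int_commute less_top)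
    show "?H X \<le> ?H (F \<inter> X) + ?H ((UNIV - F) \<inter> X)"
      using hausdorff_outer_Un[OF s, of "F \<inter> X" "(UNIV - F) \<inter> X"]
      by (simp add: Int_Un_distrib2[symmetric])
  qed
  then show ?thesis by (simp add: lambda_system_def)
qed

lemma sets_hausdorff_measure [simp, measurable_cong]: "sets (hausdorff_measure s) = sets borel"
  unfolding hausdorff_measure_def by (simp add: sets.sigma_sets_eq[of borel, simplified])

lemma space_hausdorff_measure [simp]: "space (hausdorff_measure s) = UNIV"
  unfolding hausdorff_measure_def by (simp add: space_measure_of_conv)

lemma emeasure_hausdorff_measure:
  fixes A :: "'a::metric_space set"
  assumes s: "s > 0" and A: "A \<in> sets borel"
  shows "emeasure (hausdorff_measure s) A = hausdorff_outer s A"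
proof -
  let ?H = "hausdorff_outer s :: 'a set \<Rightarrow> ennreal"
  interpret sigma_algebra UNIV "UNIV :: 'a set set"
    using sigma_algebra_Pow[of UNIV] by simp
  have ms: "measure_space UNIV (lambda_system UNIV UNIV ?H) ?H"
    by (rule caratheodory_lemma[OF outer_measure_space_hausdorff[OF s]])
  then interpret l: sigma_algebra UNIV "lambda_system UNIV UNIV ?H"
    by (simp add: measure_space_def)
  have "sets borel = sigma_sets UNIV {F :: 'a set. closed F}"
    by (simp add: borel_eq_closed)
  also have "\<dots> \<subseteq> lambda_system UNIV UNIV ?H"
    by (intro l.sigma_sets_subset) (auto intro: closed_hausdorff_measurable s)
  finally have "measure_space UNIV (sets (borel :: 'a measure)) ?H"
    using measure_down[OF ms] sets.sigma_algebra_axioms[of "borel :: 'a measure"] by simp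
  then show ?thesis
    unfolding hausdorff_measure_def measure_space_def
    using A by (intro emeasure_measure_of_sigma) auto
qed


section \<open>Square-integrable functions\<close>

definition L2 :: "'b measure \<Rightarrow> ('b \<Rightarrow> 'c::euclidean_space) set" where
  "L2 M = {f \<in> borel_measurable M. integrable M (\<lambda>x. (norm (f x))\<^sup>2)}"

definition L2_inner :: "'b measure \<Rightarrow> ('b \<Rightarrow> 'c::euclidean_space) \<Rightarrow> ('b \<Rightarrow> 'c) \<Rightarrow> real" where
  "L2_inner M f g = (\<integral>x. f x \<bullet> g x \<partial>M)"

definition L2_norm :: "'b measure \<Rightarrow> ('b \<Rightarrow> 'c::euclidean_space) \<Rightarrow> real" where
  "L2_norm M f = sqrt (\<integral>x. (norm (f x))\<^sup>2 \<partial>M)"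

definition Linf_norm :: "'b measure \<Rightarrow> ('b \<Rightarrow> 'c::euclidean_space) \<Rightarrow> ereal" where
  "Linf_norm M f = esssup M (\<lambda>x. ereal (norm (f x)))"

definition surface_on :: "'a::euclidean_space set \<Rightarrow> 'a measure" where
  "surface_on \<Sigma> = restrict_space (hausdorff_measure (DIM('a) - 1)) \<Sigma>"


section \<open>Weak derivatives and normal traces\<close>

fun C_k :: "nat \<Rightarrow> ('a::euclidean_space \<Rightarrow> real) \<Rightarrow> bool" where
  "C_k 0 \<phi> = continuous_on UNIV \<phi>"
| "C_k (Suc k) \<phi> = ((\<forall>x. \<phi> differentiable (at x)) \<and>
     (\<forall>b\<in>Basis. C_k k (\<lambda>x. frechet_derivative \<phi> (at x) b)))"

definition supp :: "('a::euclidean_space \<Rightarrow> real) \<Rightarrow> 'a set" where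
  "supp \<phi> = closure {x. \<phi> x \<noteq> 0}"

definition test_function :: "('a::euclidean_space \<Rightarrow> real) \<Rightarrow> bool" where
  "test_function \<phi> \<longleftrightarrow> (\<forall>k. C_k k \<phi>) \<and> compact (supp \<phi>)"

definition grad :: "('a::euclidean_space \<Rightarrow> real) \<Rightarrow> 'a \<Rightarrow> 'a" where
  "grad \<phi> x = (\<Sum>b\<in>Basis. frechet_derivative \<phi> (at x) b *\<^sub>R b)"

definition weak_gradient ::
  "'a::euclidean_space set \<Rightarrow> ('a \<Rightarrow> real) \<Rightarrow> ('a \<Rightarrow> 'a) \<Rightarrow> bool" where
  "weak_gradient \<Omega> \<eta> w \<longleftrightarrow>
     (\<forall>K. compact K \<and> K \<subseteq> \<Omega> \<longrightarrow> integrable (lebesgue_on K) \<eta>) \<and>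
     (\<forall>\<phi>. test_function \<phi> \<and> supp \<phi> \<subseteq> \<Omega> \<longrightarrow>
        (\<forall>b\<in>Basis. (\<integral>x. \<eta> x * (grad \<phi> x \<bullet> b) \<partial>lebesgue_on \<Omega>)
                   = - (\<integral>x. (w x \<bullet> b) * \<phi> x \<partial>lebesgue_on \<Omega>)))"

definition weak_divergence ::
  "'a::euclidean_space set \<Rightarrow> ('a \<Rightarrow> 'a) \<Rightarrow> ('a \<Rightarrow> real) \<Rightarrow> bool" where
  "weak_divergence \<Omega> q d \<longleftrightarrow>
     (\<forall>\<phi>. test_function \<phi> \<and> supp \<phi> \<subseteq> \<Omega> \<longrightarrow>
        L2_inner (lebesgue_on \<Omega>) d \<phi> = - L2_inner (lebesgue_on \<Omega>) q (grad \<phi>))"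

text \<open>
  For \<open>q\<close> in H(div) of \<open>\<Omega>\<close> with weak divergence \<open>d\<close>, the normal trace \<open>q \<bullet> n\<close>, \<open>n\<close> the outward
  unit normal, is the functional on the boundary given by Green's formula,
  \<open>\<langle>q \<bullet> n, \<phi>\<rangle> = \<integral>\<^bsub>\<Omega>\<^esub> q \<bullet> grad \<phi> + \<integral>\<^bsub>\<Omega>\<^esub> d \<phi>\<close>.  Its restriction to a part
  \<open>\<Sigma>\<close> of the boundary is obtained by testing with those \<open>\<phi>\<close> that vanish on the rest of the boundary.
  The predicate says that this restriction is represented by the function \<open>t\<close>.  The integrability
  of \<open>t \<phi>\<close> contained in \<open>has_bochner_integral\<close> is automatic when \<open>t\<close> is square-integrable, since
  a Lipschitz boundary has finite surface measure.
\<close>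

definition normal_trace ::
  "'a::euclidean_space set \<Rightarrow> 'a set \<Rightarrow> ('a \<Rightarrow> 'a) \<Rightarrow> ('a \<Rightarrow> real) \<Rightarrow> ('a \<Rightarrow> real) \<Rightarrow> bool" where
  "normal_trace \<Omega> \<Sigma> q d t \<longleftrightarrow>
     (\<forall>\<phi>. test_function \<phi> \<and> (\<forall>x\<in>frontier \<Omega> - \<Sigma>. \<phi> x = 0) \<longrightarrow>
        has_bochner_integral (surface_on \<Sigma>) (\<lambda>x. t x * \<phi> x)
          (L2_inner (lebesgue_on \<Omega>) q (grad \<phi>) + L2_inner (lebesgue_on \<Omega>) d \<phi>))"


section \<open>Geometry\<close>

text \<open>
  Near every boundary point, and after a rotation that sends the unit vector \<open>e\<close> to the last
  coordinate direction, the set is the strict epigraph of a Lipschitz function \<open>\<psi>\<close> of the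
  component \<open>y - (y \<bullet> e) e\<close> orthogonal to \<open>e\<close>.
\<close>

definition lipschitz_domain :: "'a::euclidean_space set \<Rightarrow> bool" where
  "lipschitz_domain \<Omega> \<longleftrightarrow> open \<Omega> \<and> connected \<Omega> \<and> \<Omega> \<noteq> {} \<and> bounded \<Omega> \<and>
     (\<forall>x\<in>frontier \<Omega>. \<exists>r e C \<psi>. r > 0 \<and> norm e = 1 \<and> C-lipschitz_on UNIV (\<psi> :: 'a \<Rightarrow> real) \<and>
        (\<forall>y\<in>ball x r. y \<in> \<Omega> \<longleftrightarrow> \<psi> (y - (y \<bullet> e) *\<^sub>R e) < y \<bullet> e))"

text \<open>
  A topological manifold, possibly with boundary, whose dimension is one less than that of the
  ambient space: locally homeomorphic to an open subset of a half-space of a coordinate hyperplane.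
\<close>

definition codim1_manifold :: "'a::euclidean_space set \<Rightarrow> bool" where
  "codim1_manifold \<Gamma> \<longleftrightarrow>
     (\<forall>x\<in>\<Gamma>. \<exists>U V b c. b \<in> Basis \<and> c \<in> Basis \<and> b \<noteq> c \<and>
        x \<in> U \<and> openin (top_of_set \<Gamma>) U \<and>
        openin (top_of_set {y :: 'a. y \<bullet> b = 0 \<and> y \<bullet> c \<ge> 0}) V \<and> U homeomorphic V)"

text \<open>
  The subdomains are indexed by the two-element numeral type \<open>2\<close>, whose elements are
  \<open>1\<close> and \<open>2\<close>.
\<close>

definition interface :: "(2 \<Rightarrow> 'a::euclidean_space set) \<Rightarrow> 'a set" where
  "interface \<Omega> = frontier (\<Omega> 1) \<inter> frontier (\<Omega> 2)"

definition two_domain_geometry ::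
  "'a::euclidean_space set \<Rightarrow> (2 \<Rightarrow> 'a set) \<Rightarrow> 'a set \<Rightarrow> 'a set \<Rightarrow> bool" where
  "two_domain_geometry \<Omega>0 \<Omega> D N \<longleftrightarrow>
     lipschitz_domain \<Omega>0 \<and>
     D \<subseteq> frontier \<Omega>0 \<and> N \<subseteq> frontier \<Omega>0 \<and> frontier \<Omega>0 = closure D \<union> closure N \<and> D \<inter> N = {} \<and>
     (\<forall>l. lipschitz_domain (\<Omega> l)) \<and>
     closure \<Omega>0 = closure (\<Omega> 1) \<union> closure (\<Omega> 2) \<and> \<Omega> 1 \<inter> \<Omega> 2 = {} \<and>
     codim1_manifold (interface \<Omega>) \<and>
     (\<forall>l. emeasure (hausdorff_measure (DIM('a) - 1)) (frontier (\<Omega> l) \<inter> D) > 0)"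


section \<open>Function spaces\<close>

text \<open>
  An element of H(div) whose normal trace on the interface is a function is stored together with
  representatives of its weak divergence and of this normal trace.  On Lipschitz subdomains both
  are determined by the vector field up to null sets, so quantifying over such records is
  quantifying over vector fields and over the choice of representatives.
\<close>

record 'a flux =
  vfield :: "'a \<Rightarrow> 'a"
  divg :: "'a \<Rightarrow> real"
  ntrace :: "'a \<Rightarrow> real"

definition Q_sub ::
  "'a::euclidean_space set \<Rightarrow> 'a set \<Rightarrow> 'a set \<Rightarrow> 'a flux set" where
  "Q_sub \<Omega> \<Gamma> N = {q.
     vfield q \<in> L2 (lebesgue_on \<Omega>) \<and>
     divg q \<in> L2 (lebesgue_on \<Omega>) \<and> weak_divergence \<Omega> (vfield q) (divg q) \<and>
     ntrace q \<in> L2 (surface_on \<Gamma>) \<and> normal_trace \<Omega> \<Gamma> (vfield q) (divg q) (ntrace q) \<and>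
     normal_trace \<Omega> (N \<inter> frontier \<Omega>) (vfield q) (divg q) (\<lambda>_. 0)}"

definition Q_space ::
  "(2 \<Rightarrow> 'a::euclidean_space set) \<Rightarrow> 'a set \<Rightarrow> (2 \<Rightarrow> 'a flux) set" where
  "Q_space \<Omega> N = {q. \<forall>l. q l \<in> Q_sub (\<Omega> l) (interface \<Omega>) N}"

definition P_space :: "(2 \<Rightarrow> 'a::euclidean_space set) \<Rightarrow> (2 \<Rightarrow> 'a \<Rightarrow> real) set" where
  "P_space \<Omega> = {p. \<forall>l. p l \<in> L2 (lebesgue_on (\<Omega> l))}"

definition G_space :: "(2 \<Rightarrow> 'a::euclidean_space set) \<Rightarrow> (2 \<Rightarrow> 'a \<Rightarrow> real) set" where
  "G_space \<Omega> = {g. \<forall>l. g l \<in> L2 (surface_on (interface \<Omega>))}"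

definition pair_norm ::
  "(2 \<Rightarrow> 'a::euclidean_space set) \<Rightarrow> (2 \<Rightarrow> 'a \<Rightarrow> 'c::euclidean_space) \<Rightarrow> real" where
  "pair_norm \<Omega> u = sqrt (\<Sum>l\<in>UNIV. (L2_norm (lebesgue_on (\<Omega> l)) (u l))\<^sup>2)"


section \<open>The variational problems\<close>

text \<open>
  The flux equation on subdomain \<open>l\<close>, with the saturation entering the inverse permeability
  evaluated at the pressure \<open>pk\<close>; \<open>w\<close> is the gradient of \<open>\<eta>\<close>.
\<close>

definition flux_equation ::
  "(2 \<Rightarrow> 'a::euclidean_space set) \<Rightarrow> real \<Rightarrow> (2 \<Rightarrow> real \<Rightarrow> real) \<Rightarrow> (2 \<Rightarrow> real \<Rightarrow> real) \<Rightarrow>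
   (2 \<Rightarrow> 'a \<Rightarrow> 'a) \<Rightarrow> (2 \<Rightarrow> 'a \<Rightarrow> real) \<Rightarrow>
   (2 \<Rightarrow> 'a flux) \<Rightarrow> (2 \<Rightarrow> 'a \<Rightarrow> real) \<Rightarrow> (2 \<Rightarrow> 'a \<Rightarrow> real) \<Rightarrow> (2 \<Rightarrow> 'a flux) \<Rightarrow> 2 \<Rightarrow> bool" where
  "flux_equation \<Omega> \<alpha> k S w pk q p g v l \<longleftrightarrow>
     L2_inner (lebesgue_on (\<Omega> l)) (\<lambda>x. (1 / k l (S l (pk l x))) *\<^sub>R vfield (q l) x) (vfield (v l))
     - L2_inner (lebesgue_on (\<Omega> l)) (p l) (divg (v l))
     + \<alpha> * L2_inner (surface_on (interface \<Omega>)) (ntrace (q l)) (ntrace (v l))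
     = L2_inner (lebesgue_on (\<Omega> l)) (w l) (vfield (v l))
       - L2_inner (surface_on (interface \<Omega>)) (g l) (ntrace (v l))"

definition robin_equation ::
  "(2 \<Rightarrow> 'a::euclidean_space set) \<Rightarrow> real \<Rightarrow>
   (2 \<Rightarrow> 'a \<Rightarrow> real) \<Rightarrow> (2 \<Rightarrow> 'a flux) \<Rightarrow> (2 \<Rightarrow> 'a \<Rightarrow> real) \<Rightarrow> (2 \<Rightarrow> 'a \<Rightarrow> real) \<Rightarrow> bool" where
  "robin_equation \<Omega> \<alpha> g q g' h \<longleftrightarrow>
     (\<forall>l j. l \<noteq> j \<longrightarrow>
        L2_inner (surface_on (interface \<Omega>)) (g l) (h l) =
        L2_inner (surface_on (interface \<Omega>)) (\<lambda>x. 2 * \<alpha> * ntrace (q j) x + g' j x) (h l))"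

definition limit_problem ::
  "(2 \<Rightarrow> 'a::euclidean_space set) \<Rightarrow> 'a set \<Rightarrow> real \<Rightarrow> real \<Rightarrow>
   (2 \<Rightarrow> real \<Rightarrow> real) \<Rightarrow> (2 \<Rightarrow> real \<Rightarrow> real) \<Rightarrow> (2 \<Rightarrow> 'a \<Rightarrow> real) \<Rightarrow> (2 \<Rightarrow> 'a \<Rightarrow> 'a) \<Rightarrow>
   (2 \<Rightarrow> 'a \<Rightarrow> real) \<Rightarrow>
   (2 \<Rightarrow> 'a flux) \<Rightarrow> (2 \<Rightarrow> 'a \<Rightarrow> real) \<Rightarrow> (2 \<Rightarrow> 'a \<Rightarrow> real) \<Rightarrow> bool" where
  "limit_problem \<Omega> N \<tau> \<alpha> k S F w p_prev q p g \<longleftrightarrow>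
     q \<in> Q_space \<Omega> N \<and> p \<in> P_space \<Omega> \<and> g \<in> G_space \<Omega> \<and>
     (\<forall>v\<in>Q_space \<Omega> N. \<forall>l. flux_equation \<Omega> \<alpha> k S w p q p g v l) \<and>
     (\<forall>r\<in>P_space \<Omega>. \<forall>l.
        L2_inner (lebesgue_on (\<Omega> l)) (\<lambda>x. S l (p l x)) (r l)
        + \<tau> * L2_inner (lebesgue_on (\<Omega> l)) (divg (q l)) (r l)
        = \<tau> * L2_inner (lebesgue_on (\<Omega> l)) (F l) (r l)
          + L2_inner (lebesgue_on (\<Omega> l)) (\<lambda>x. S l (p_prev l x)) (r l)) \<and>
     (\<forall>h\<in>G_space \<Omega>. robin_equation \<Omega> \<alpha> g q g h)"

definition iteration_step ::
  "(2 \<Rightarrow> 'a::euclidean_space set) \<Rightarrow> 'a set \<Rightarrow> real \<Rightarrow> real \<Rightarrow> (2 \<Rightarrow> real) \<Rightarrow>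
   (2 \<Rightarrow> real \<Rightarrow> real) \<Rightarrow> (2 \<Rightarrow> real \<Rightarrow> real) \<Rightarrow> (2 \<Rightarrow> 'a \<Rightarrow> real) \<Rightarrow> (2 \<Rightarrow> 'a \<Rightarrow> 'a) \<Rightarrow>
   (2 \<Rightarrow> 'a \<Rightarrow> real) \<Rightarrow>
   (2 \<Rightarrow> 'a flux) \<Rightarrow> (2 \<Rightarrow> 'a \<Rightarrow> real) \<Rightarrow> (2 \<Rightarrow> 'a \<Rightarrow> real) \<Rightarrow>
   (2 \<Rightarrow> 'a flux) \<Rightarrow> (2 \<Rightarrow> 'a \<Rightarrow> real) \<Rightarrow> (2 \<Rightarrow> 'a \<Rightarrow> real) \<Rightarrow> bool" where
  "iteration_step \<Omega> N \<tau> \<alpha> L k S F w p_prev q' p' g' q p g \<longleftrightarrow>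
     g \<in> G_space \<Omega> \<and> (\<forall>h\<in>G_space \<Omega>. robin_equation \<Omega> \<alpha> g q' g' h) \<and>
     q \<in> Q_space \<Omega> N \<and> p \<in> P_space \<Omega> \<and>
     (\<forall>v\<in>Q_space \<Omega> N. \<forall>l. flux_equation \<Omega> \<alpha> k S w p' q p g v l) \<and>
     (\<forall>r\<in>P_space \<Omega>. \<forall>l.
        L l * L2_inner (lebesgue_on (\<Omega> l)) (p l) (r l)
        + \<tau> * L2_inner (lebesgue_on (\<Omega> l)) (divg (q l)) (r l)
        = \<tau> * L2_inner (lebesgue_on (\<Omega> l)) (F l) (r l)
          - L2_inner (lebesgue_on (\<Omega> l)) (\<lambda>x. S l (p' l x) - S l (p_prev l x)) (r l)
          + L l * L2_inner (lebesgue_on (\<Omega> l)) (p' l) (r l))"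

end

theory Submission
  imports Defs
begin

text \<open>
  Write \<open>e_q\<close>, \<open>e_p\<close>, \<open>e_g\<close>, \<open>e_S\<close> for the errors of an iterate.  Subtracting the flux equations and
  testing with \<open>e_q\<close>, subtracting the mass equations and testing with \<open>e_p\<close>, and completing squares
  (monotonicity and Lipschitz continuity of \<open>S\<close> give \<open>e_S e_p \<ge> e_S\<^sup>2 / L\<^sub>S\<close> within one iterate) shows that the energy
  \<open>\<Sum> L/2 \<parallel>e_p\<parallel>\<^sup>2 + \<tau>/(4 \<alpha>) \<parallel>e_g\<parallel>\<^sup>2\<close>, with \<open>e_g\<close> taken one step later, decreases in each step by at
  least a positive multiple of \<open>\<parallel>e_q\<parallel>\<^sup>2 + \<parallel>e_S\<parallel>\<^sup>2\<close>, with \<open>e_S\<close> one step earlier than \<open>e_q\<close>.  The interface terms telescope because the Robin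
  exchange turns \<open>\<alpha> \<parallel>e_q \<bullet> n\<parallel>\<^sup>2 + \<langle>e_g, e_q \<bullet> n\<rangle>\<close> into a difference of squares.  Hence the
  decrements are summable.
\<close>

section \<open>Calculus of square-integrable functions and of \<open>L2_inner\<close>\<close>

lemma integrable_inner_L2:
  assumes "f \<in> L2 M" "g \<in> L2 M"
  shows "integrable M (\<lambda>x. f x \<bullet> g x)"
proof (rule Bochner_Integration.integrable_bound)
  show "integrable M (\<lambda>x. (norm (f x))\<^sup>2 + (norm (g x))\<^sup>2)"
    using assms by (auto simp: L2_def)
  have [measurable]: "f \<in> borel_measurable M" "g \<in> borel_measurable M"
    using assms by (auto simp: L2_def)
  show "(\<lambda>x. f x \<bullet> g x) \<in> borel_measurable M" by measurable
  show "AE x in M. norm (f x \<bullet> g x) \<le> norm ((norm (f x))\<^sup>2 + (norm (g x))\<^sup>2)"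
  proof (rule AE_I2)
    fix x
    have "\<bar>f x \<bullet> g x\<bar> \<le> norm (f x) * norm (g x)" by (rule Cauchy_Schwarz_ineq2)
    also have "\<dots> \<le> (norm (f x))\<^sup>2 + (norm (g x))\<^sup>2"
      using sum_squares_bound[of "norm (f x)" "norm (g x)"]
        mult_nonneg_nonneg[OF norm_ge_zero[of "f x"] norm_ge_zero[of "g x"]] by linarith
    finally show "norm (f x \<bullet> g x) \<le> norm ((norm (f x))\<^sup>2 + (norm (g x))\<^sup>2)" by simp
  qed
qed

lemma L2_bounded_scaleR:
  assumes f: "f \<in> L2 M" and h: "h \<in> borel_measurable M" "\<And>x. \<bar>h x\<bar> \<le> C"
  shows "(\<lambda>x. h x *\<^sub>R f x) \<in> L2 M"
proof -
  have [measurable]: "f \<in> borel_measurable M" "h \<in> borel_measurable M"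
    using assms by (auto simp: L2_def)
  have "integrable M (\<lambda>x. (norm (h x *\<^sub>R f x))\<^sup>2)"
  proof (rule Bochner_Integration.integrable_bound)
    show "integrable M (\<lambda>x. C\<^sup>2 * (norm (f x))\<^sup>2)" using f by (auto simp: L2_def)
    show "AE x in M. norm ((norm (h x *\<^sub>R f x))\<^sup>2) \<le> norm (C\<^sup>2 * (norm (f x))\<^sup>2)"
    proof (rule AE_I2)
      fix x
      have "\<bar>h x\<bar>\<^sup>2 \<le> C\<^sup>2" using h(2) by (intro power_mono) auto
      then show "norm ((norm (h x *\<^sub>R f x))\<^sup>2) \<le> norm (C\<^sup>2 * (norm (f x))\<^sup>2)"
        by (simp add: power_mult_distrib mult_right_mono)
    qed
  qed measurable
  then show ?thesis by (simp add: L2_def)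
qed

lemma L2_scaleR: "f \<in> L2 M \<Longrightarrow> (\<lambda>x. c *\<^sub>R f x) \<in> L2 M"
  by (rule L2_bounded_scaleR[where C = "\<bar>c\<bar>"]) auto

lemma L2_cmult:
  fixes f :: "'b \<Rightarrow> real"
  shows "f \<in> L2 M \<Longrightarrow> (\<lambda>x. c * f x) \<in> L2 M"
  using L2_scaleR[of f M c] by simp

lemma L2_add:
  assumes "f \<in> L2 M" "g \<in> L2 M"
  shows "(\<lambda>x. f x + g x) \<in> L2 M"
proof -
  have [measurable]: "f \<in> borel_measurable M" "g \<in> borel_measurable M"
    using assms by (auto simp: L2_def)
  have "integrable M (\<lambda>x. (norm (f x))\<^sup>2 + 2 * (f x \<bullet> g x) + (norm (g x))\<^sup>2)"
    using assms integrable_inner_L2[OF assms] by (auto simp: L2_def)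
  also have "(\<lambda>x. (norm (f x))\<^sup>2 + 2 * (f x \<bullet> g x) + (norm (g x))\<^sup>2) = (\<lambda>x. (norm (f x + g x))\<^sup>2)"
    by (simp add: power2_norm_eq_inner inner_add inner_commute algebra_simps)
  finally show ?thesis by (simp add: L2_def)
qed

lemma L2_diff: "f \<in> L2 M \<Longrightarrow> g \<in> L2 M \<Longrightarrow> (\<lambda>x. f x - g x) \<in> L2 M"
  using L2_add[of f M "\<lambda>x. (-1) *\<^sub>R g x"] L2_scaleR[of g M "-1"] by simp

lemma L2_bounded:
  fixes f :: "'b \<Rightarrow> real"
  assumes "finite_measure M" "f \<in> borel_measurable M" "\<And>x. \<bar>f x\<bar> \<le> C"
  shows "f \<in> L2 M"
proof -
  interpret finite_measure M by fact
  have "(\<lambda>_. 1 :: real) \<in> L2 M" by (simp add: L2_def)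
  from L2_bounded_scaleR[OF this assms(2,3)] show ?thesis by simp
qed

lemma L2_inner_commute: "L2_inner M f g = L2_inner M g f"
  by (simp add: L2_inner_def inner_commute)

lemma L2_norm_power2: "(L2_norm M f)\<^sup>2 = L2_inner M f f"
  by (simp add: L2_norm_def L2_inner_def power2_norm_eq_inner)

lemma L2_inner_add_left:
  assumes "f \<in> L2 M" "g \<in> L2 M" "h \<in> L2 M"
  shows "L2_inner M (\<lambda>x. f x + g x) h = L2_inner M f h + L2_inner M g h"
  using assms by (simp add: L2_inner_def inner_add_left integrable_inner_L2)

lemma L2_inner_diff_left:
  assumes "f \<in> L2 M" "g \<in> L2 M" "h \<in> L2 M"
  shows "L2_inner M (\<lambda>x. f x - g x) h = L2_inner M f h - L2_inner M g h"
  using assms by (simp add: L2_inner_def inner_diff_left integrable_inner_L2)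

lemma L2_inner_diff_right:
  assumes "f \<in> L2 M" "g \<in> L2 M" "h \<in> L2 M"
  shows "L2_inner M h (\<lambda>x. f x - g x) = L2_inner M h f - L2_inner M h g"
  using L2_inner_diff_left[OF assms] by (simp add: L2_inner_commute)

lemma L2_inner_cmult_left:
  fixes f :: "'b \<Rightarrow> real"
  shows "L2_inner M (\<lambda>x. c * f x) h = c * L2_inner M f h"
  by (simp add: L2_inner_def mult.assoc mult.left_commute[of _ c])

text \<open>Testing with \<open>f\<close> and with \<open>w\<close> and using symmetry gives
  \<open>\<langle>f, f\<rangle> = \<langle>w, f\<rangle> = \<langle>f, w\<rangle> = \<langle>w,
  w\<rangle>\<close>. Norms can thus be read off a weak identity without first proving equality
  almost everywhere.\<close>

lemma L2_inner_self_eqI: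
  assumes "f \<in> L2 M" "w \<in> L2 M" "\<And>h. h \<in> L2 M \<Longrightarrow> L2_inner M f h = L2_inner M w h"
  shows "L2_inner M f f = L2_inner M w w"
  using assms(3)[OF assms(1)] assms(3)[OF assms(2)] L2_inner_commute[of M f w] by simp

section \<open>Pointwise inequalities behind the energy estimate\<close>

text \<open>By monotonicity both increments have the same sign, so the product equals the product of
  absolute values, and the Lipschitz bound replaces one factor. This is the source of the
  \<open>1 / L\<^sub>S l\<close> in the time step restriction.\<close>

lemma mono_lipschitz_cocoercive:
  fixes S :: "real \<Rightarrow> real"
  assumes "mono S" "C-lipschitz_on UNIV S" "C > 0"
  shows "(S a - S b)\<^sup>2 / C \<le> (S a - S b) * (a - b)"
proof -
  have eq: "(S a - S b) * (a - b) = \<bar>S a - S b\<bar> * \<bar>a - b\<bar>"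
    using monoD[OF assms(1), of a b] monoD[OF assms(1), of b a]
    by (cases "a \<le> b") (simp_all add: abs_of_nonneg abs_of_nonpos algebra_simps)
  have "\<bar>S a - S b\<bar> \<le> C * \<bar>a - b\<bar>"
    using lipschitz_onD[OF assms(2), of a b] by (simp add: dist_real_def)
  then have "\<bar>S a - S b\<bar> * \<bar>S a - S b\<bar> \<le> \<bar>S a - S b\<bar> * (C * \<bar>a - b\<bar>)"
    by (rule mult_left_mono) simp
  then have "(S a - S b)\<^sup>2 \<le> ((S a - S b) * (a - b)) * C"
    unfolding eq by (simp add: power2_eq_square mult.commute mult.left_commute)
  then show ?thesis using assms(3) by (simp add: divide_le_eq)
qed

text \<open>Weighted Young inequality, from expanding the square of
  \<open>m * a - b\<close>.\<close>

lemma young_mult: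
  fixes a b m :: real
  assumes "m > 0"
  shows "a * b \<le> m / 2 * a\<^sup>2 + b\<^sup>2 / (2 * m)"
proof -
  have "0 \<le> (m * a - b)\<^sup>2 / (2 * m)" using assms by simp
  also have "\<dots> = m / 2 * a\<^sup>2 + b\<^sup>2 / (2 * m) - a * b"
    using assms by (simp add: power2_eq_square field_simps)
  finally show ?thesis by simp
qed

text \<open>Split the first factor of the inner product as \<open>\<kappa> *\<^sub>R (un - u) +
  (\<kappa>n - \<kappa>) *\<^sub>R un\<close>. The first part is coercive with constant
  \<open>m\<close>. The second contains only the limit flux \<open>un\<close>, so a bound on the
  limit flux alone suffices; Young's inequality absorbs it at the cost of half the
  coercivity.\<close>

lemma flux_pointwise_bound:
  fixes u un :: "'c::real_inner"
  assumes m: "m > 0" "m \<le> \<kappa>" and K: "K \<ge> 0" "\<bar>\<kappa>n - \<kappa>\<bar> \<le> K * \<bar>s\<bar>" and B: "norm un \<le> B"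
  shows "m / 2 * (norm (un - u))\<^sup>2 - K\<^sup>2 * B\<^sup>2 / (2 * m) * s\<^sup>2
           \<le> (\<kappa>n *\<^sub>R un - \<kappa> *\<^sub>R u) \<bullet> (un - u)"
proof -
  let ?e = "un - u"
  have "\<bar>\<kappa>n - \<kappa>\<bar> * norm un \<le> (K * \<bar>s\<bar>) * B"
    using assms by (intro mult_mono) auto
  moreover have "\<bar>((\<kappa>n - \<kappa>) *\<^sub>R un) \<bullet> ?e\<bar> \<le> \<bar>\<kappa>n - \<kappa>\<bar> * norm un * norm ?e"
    using Cauchy_Schwarz_ineq2[of "(\<kappa>n - \<kappa>) *\<^sub>R un" ?e] by simp
  ultimately have "\<bar>((\<kappa>n - \<kappa>) *\<^sub>R un) \<bullet> ?e\<bar> \<le> (K * \<bar>s\<bar>) * B * norm ?e"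
    by (meson mult_right_mono norm_ge_zero order_trans)
  also have "\<dots> = norm ?e * (K * \<bar>s\<bar> * B)" by simp
  also have "\<dots> \<le> m / 2 * (norm ?e)\<^sup>2 + (K * \<bar>s\<bar> * B)\<^sup>2 / (2 * m)"
    by (rule young_mult[OF m(1)])
  also have "(K * \<bar>s\<bar> * B)\<^sup>2 / (2 * m) = K\<^sup>2 * B\<^sup>2 / (2 * m) * s\<^sup>2"
    by (simp add: power_mult_distrib)
  finally have 1: "\<bar>((\<kappa>n - \<kappa>) *\<^sub>R un) \<bullet> ?e\<bar> \<le> m / 2 * (norm ?e)\<^sup>2 + K\<^sup>2 * B\<^sup>2 / (2 * m) * s\<^sup>2" .
  have 2: "m * (norm ?e)\<^sup>2 \<le> \<kappa> * (norm ?e)\<^sup>2" using m by (intro mult_right_mono) auto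
  have "(\<kappa>n *\<^sub>R un - \<kappa> *\<^sub>R u) \<bullet> ?e = \<kappa> * (norm ?e)\<^sup>2 + ((\<kappa>n - \<kappa>) *\<^sub>R un) \<bullet> ?e"
    by (simp add: power2_norm_eq_inner algebra_simps)
  then show ?thesis using 1 2 by linarith
qed

text \<open>Here \<open>s\<close> and \<open>e0\<close> are the saturation and pressure errors
  before a step, \<open>e\<close> the pressure error after it. The lagged product splits as
  \<open>s * e = s * e0 + s * (e - e0)\<close>: cocoercivity handles the first part. Young's
  inequality with weight \<open>L\<close> handles the second, and its term in
  \<open>(e - e0)\<^sup>2\<close> cancels the one produced by
  \<open>L * (e - e0) * e\<close>.\<close>

lemma pressure_pointwise_bound:
  fixes e e0 s L C :: real
  assumes "L > 0" "s\<^sup>2 / C \<le> s * e0"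
  shows "(1 / C - 1 / (2 * L)) * s\<^sup>2 + L / 2 * e\<^sup>2 - L / 2 * e0\<^sup>2 \<le> L * (e - e0) * e + s * e"
proof -
  have "- s * (e - e0) \<le> L / 2 * (e - e0)\<^sup>2 + s\<^sup>2 / (2 * L)"
    using young_mult[of L "e - e0" "- s"] assms(1) by (simp add: mult.commute)
  moreover have "L * (e - e0) * e = L / 2 * e\<^sup>2 - L / 2 * e0\<^sup>2 + L / 2 * (e - e0)\<^sup>2"
    by (simp add: power2_eq_square field_simps)
  moreover have "(1 / C - 1 / (2 * L)) * s\<^sup>2 = s\<^sup>2 / C - s\<^sup>2 / (2 * L)"
    by (simp add: left_diff_distrib)
  moreover have "s * e = s * (e - e0) + s * e0" by (simp add: algebra_simps)
  ultimately show ?thesis using assms(2) by linarith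
qed

section \<open>Energy estimate for one step on one subdomain\<close>

text \<open>
  The flux equations are only tested with the two solution fields: by linearity in the test function
  this gives the test with their difference, without showing that \<open>Q_space\<close> is a vector space.
\<close>

lemma subdomain_energy:
  fixes M :: "'b measure" and B :: "'d measure" and un u :: "'b \<Rightarrow> 'c::euclidean_space"
    and \<kappa> S :: "real \<Rightarrow> real"
  assumes fin: "finite_measure M"
    and u: "un \<in> L2 M" "u \<in> L2 M" and d: "dn \<in> L2 M" "d \<in> L2 M"
    and t: "tn \<in> L2 B" "t \<in> L2 B" and gg: "gn \<in> L2 B" "g \<in> L2 B"
    and p: "pn \<in> L2 M" "p \<in> L2 M" "p0 \<in> L2 M" "pp \<in> L2 M"
    and \<kappa>: "\<kappa> ` {0..1} \<subseteq> {m..m'}" "K-lipschitz_on {0..1} \<kappa>" "m > 0"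
    and S: "range S \<subseteq> {0..1}" "mono S" "C-lipschitz_on UNIV S" "C > 0"
    and bound: "AE x in M. norm (un x) \<le> Q"
    and pos: "\<tau> > 0" "L > 0"
    and flux_n: "\<And>v dv tv. (v, dv, tv) \<in> {(un, dn, tn), (u, d, t)} \<Longrightarrow>
      L2_inner M (\<lambda>x. \<kappa> (S (pn x)) *\<^sub>R un x) v - L2_inner M pn dv + \<alpha> * L2_inner B tn tv
        = L2_inner M w v - L2_inner B gn tv"
    and flux: "\<And>v dv tv. (v, dv, tv) \<in> {(un, dn, tn), (u, d, t)} \<Longrightarrow>
      L2_inner M (\<lambda>x. \<kappa> (S (p0 x)) *\<^sub>R u x) v - L2_inner M p dv + \<alpha> * L2_inner B t tv
        = L2_inner M w v - L2_inner B g tv"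
    and mass_n: "\<And>r. r \<in> L2 M \<Longrightarrow>
      L2_inner M (\<lambda>x. S (pn x)) r + \<tau> * L2_inner M dn r
        = \<tau> * L2_inner M F r + L2_inner M (\<lambda>x. S (pp x)) r"
    and mass: "\<And>r. r \<in> L2 M \<Longrightarrow>
      L * L2_inner M p r + \<tau> * L2_inner M d r
        = \<tau> * L2_inner M F r - L2_inner M (\<lambda>x. S (p0 x) - S (pp x)) r + L * L2_inner M p0 r"
  shows "\<tau> * m / 2 * (L2_norm M (\<lambda>x. un x - u x))\<^sup>2
      + (1 / C - 1 / (2 * L) - \<tau> * K\<^sup>2 * Q\<^sup>2 / (2 * m)) * (L2_norm M (\<lambda>x. S (pn x) - S (p0 x)))\<^sup>2
      + L / 2 * (L2_norm M (\<lambda>x. pn x - p x))\<^sup>2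
      + \<tau> * (\<alpha> * L2_inner B (\<lambda>x. tn x - t x) (\<lambda>x. tn x - t x)
             + L2_inner B (\<lambda>x. gn x - g x) (\<lambda>x. tn x - t x))
    \<le> L / 2 * (L2_norm M (\<lambda>x. pn x - p0 x))\<^sup>2"
proof -
  have Scont: "S \<in> borel_measurable borel"
    using S(3) by (intro borel_measurable_continuous_onI lipschitz_on_continuous_on)
  have S01: "S x \<in> {0..1}" for x using S(1) by (rule subsetD) simp
  have "continuous_on UNIV (\<lambda>x. \<kappa> (S x))"
    by (rule continuous_on_compose2[OF lipschitz_on_continuous_on[OF \<kappa>(2)]
          lipschitz_on_continuous_on[OF S(3)]]) (use S01 in auto)
  then have \<kappa>meas: "(\<lambda>x. \<kappa> (S x)) \<in> borel_measurable borel"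
    by (rule borel_measurable_continuous_onI)
  have \<kappa>b: "m \<le> \<kappa> (S x)" "\<kappa> (S x) \<le> m'" for x using \<kappa>(1) S01[of x] by (auto simp: image_subset_iff)
  have meas: "r \<in> borel_measurable M" if "r \<in> L2 M" for r :: "'b \<Rightarrow> real"
    using that by (simp add: L2_def)
  have SL2: "(\<lambda>x. S (r x)) \<in> L2 M" if "r \<in> L2 M" for r
    by (rule L2_bounded[OF fin measurable_compose[OF meas[OF that] Scont], of 1]) (use S01 in auto)
  have \<kappa>L2: "(\<lambda>x. \<kappa> (S (r x)) *\<^sub>R v x) \<in> L2 M" if "r \<in> L2 M" "v \<in> L2 M" for r and v :: "'b \<Rightarrow> 'c"
  proof (rule L2_bounded_scaleR[OF that(2) measurable_compose[OF meas[OF that(1)] \<kappa>meas]])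
    show "\<bar>\<kappa> (S (r x))\<bar> \<le> m'" for x using \<kappa>b[of "r x"] \<kappa>(3) by simp
  qed
  define eu where "eu x = un x - u x" for x
  define es where "es x = S (pn x) - S (p0 x)" for x
  define e where "e x = pn x - p x" for x
  define e0 where "e0 x = pn x - p0 x" for x
  define z where "z x = \<kappa> (S (pn x)) *\<^sub>R un x - \<kappa> (S (p0 x)) *\<^sub>R u x" for x
  note defs = eu_def[abs_def] es_def[abs_def] e_def[abs_def] e0_def[abs_def] z_def[abs_def]
  note mem = u d t gg p SL2[OF p(1)] SL2[OF p(3)] SL2[OF p(4)] \<kappa>L2[OF p(1) u(1)] \<kappa>L2[OF p(3) u(2)]
  have L2e: "eu \<in> L2 M" "es \<in> L2 M" "e \<in> L2 M" "e0 \<in> L2 M" "z \<in> L2 M"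
    unfolding defs using mem by (auto intro!: L2_diff)
  have dt: "(\<lambda>x. dn x - d x) \<in> L2 M" "(\<lambda>x. tn x - t x) \<in> L2 B"
    using mem by (auto intro!: L2_diff)
  \<comment> \<open>Limit equation minus scheme equation, tested with \<open>un\<close>, minus the
    same difference tested with \<open>u\<close>. The source terms in \<open>w\<close>
    cancel.\<close>
  have err: "L2_inner M z eu - L2_inner M e (\<lambda>x. dn x - d x)
      + (\<alpha> * L2_inner B (\<lambda>x. tn x - t x) (\<lambda>x. tn x - t x)
         + L2_inner B (\<lambda>x. gn x - g x) (\<lambda>x. tn x - t x)) = 0"
    using flux_n[of un dn tn] flux_n[of u d t] flux[of un dn tn] flux[of u d t]
    unfolding defs using dt mem L2_diff[OF u]
    by (simp add: L2_inner_diff_left L2_inner_diff_right algebra_simps)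
  have "\<tau> * L2_inner M (\<lambda>x. dn x - d x) e = \<tau> * L2_inner M dn e - \<tau> * L2_inner M d e"
    using mem L2e by (simp add: L2_inner_diff_left right_diff_distrib)
  moreover have "L2_inner M es e = L2_inner M (\<lambda>x. S (pn x)) e - L2_inner M (\<lambda>x. S (p0 x)) e"
    unfolding es_def[abs_def] using mem L2e by (simp add: L2_inner_diff_left)
  moreover have "L2_inner M (\<lambda>x. S (p0 x) - S (pp x)) e
      = L2_inner M (\<lambda>x. S (p0 x)) e - L2_inner M (\<lambda>x. S (pp x)) e"
    using mem L2e by (simp add: L2_inner_diff_left)
  \<comment> \<open>The limit pressure drops out of \<open>e - e0\<close>, leaving the increment
    between consecutive iterates on which the stabilization acts.\<close>
  moreover have "L * L2_inner M (\<lambda>x. e x - e0 x) e = L * L2_inner M p0 e - L * L2_inner M p e"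
  proof -
    have "(\<lambda>x. e x - e0 x) = (\<lambda>x. p0 x - p x)" by (simp add: e_def e0_def)
    then show ?thesis using mem L2e by (simp add: L2_inner_diff_left right_diff_distrib)
  qed
  ultimately have mass_err: "\<tau> * L2_inner M e (\<lambda>x. dn x - d x)
      = - (L * L2_inner M (\<lambda>x. e x - e0 x) e) - L2_inner M es e"
    using mass_n[OF L2e(3)] mass[OF L2e(3)]
    unfolding L2_inner_commute[of M e] by linarith
  \<comment> \<open>\<open>b\<close> is the loss from Young's inequality in the flux bound;
    \<open>c\<close> is what remains of the cocoercivity gain after both losses.\<close>
  define b where "b = K\<^sup>2 * Q\<^sup>2 / (2 * m)"
  define c where "c = 1 / C - 1 / (2 * L) - \<tau> * K\<^sup>2 * Q\<^sup>2 / (2 * m)"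
  have K: "K \<ge> 0" using \<kappa>(2) by (rule lipschitz_on_nonneg)
  \<comment> \<open>The sum of \<open>\<tau>\<close> times the flux bound and the pressure bound. It
    holds only almost everywhere because the bound on \<open>un\<close> does.\<close>
  have pt: "AE x in M. \<tau> * m / 2 * (eu x \<bullet> eu x) + c * (es x \<bullet> es x) + L / 2 * (e x \<bullet> e x)
        - L / 2 * (e0 x \<bullet> e0 x)
      \<le> \<tau> * (z x \<bullet> eu x) + L * ((e x - e0 x) \<bullet> e x) + es x \<bullet> e x"
    using bound
  proof eventually_elim
    case (elim x)
    have "\<bar>\<kappa> (S (pn x)) - \<kappa> (S (p0 x))\<bar> \<le> K * \<bar>es x\<bar>"
      using lipschitz_onD[OF \<kappa>(2) S01[of "pn x"] S01[of "p0 x"]] by (simp add: dist_real_def es_def)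
    from flux_pointwise_bound[OF \<kappa>(3) \<kappa>b(1) K this elim, of "u x"]
    have "m / 2 * (norm (eu x))\<^sup>2 - K\<^sup>2 * Q\<^sup>2 / (2 * m) * (es x)\<^sup>2 \<le> z x \<bullet> eu x"
      by (simp add: eu_def z_def)
    then have "\<tau> * (m / 2 * (norm (eu x))\<^sup>2 - b * (es x)\<^sup>2) \<le> \<tau> * (z x \<bullet> eu x)"
      unfolding b_def
      using pos(1) by (intro mult_left_mono) auto
    moreover have "(1 / C - 1 / (2 * L)) * (es x)\<^sup>2 + L / 2 * (e x)\<^sup>2 - L / 2 * (e0 x)\<^sup>2
        \<le> L * (e x - e0 x) * e x + es x * e x"
      using mono_lipschitz_cocoercive[OF S(2-4), of "pn x" "p0 x"]
      by (intro pressure_pointwise_bound pos) (simp add: es_def e0_def)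
    moreover have "c * (es x)\<^sup>2 = (1 / C - 1 / (2 * L)) * (es x)\<^sup>2 - \<tau> * (b * (es x)\<^sup>2)"
      by (simp add: c_def b_def left_diff_distrib)
    ultimately have "\<tau> * m / 2 * (norm (eu x))\<^sup>2 + c * (es x)\<^sup>2 + L / 2 * (e x)\<^sup>2 - L / 2 * (e0 x)\<^sup>2
        \<le> \<tau> * (z x \<bullet> eu x) + L * (e x - e0 x) * e x + es x * e x"
      by (simp add: algebra_simps)
    then show ?case
      unfolding power2_norm_eq_inner by (simp add: power2_eq_square mult.assoc)
  qed
  note ints = integrable_inner_L2[OF L2e(1) L2e(1)] integrable_inner_L2[OF L2e(2) L2e(2)]
    integrable_inner_L2[OF L2e(3) L2e(3)] integrable_inner_L2[OF L2e(4) L2e(4)]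
    integrable_inner_L2[OF L2e(5) L2e(1)] integrable_inner_L2[OF L2e(2) L2e(3)]
    integrable_inner_L2[OF L2_diff[OF L2e(3,4)] L2e(3)]
  have "\<tau> * m / 2 * L2_inner M eu eu + c * L2_inner M es es + L / 2 * L2_inner M e e
        - L / 2 * L2_inner M e0 e0
      = (\<integral>x. \<tau> * m / 2 * (eu x \<bullet> eu x) + c * (es x \<bullet> es x) + L / 2 * (e x \<bullet> e x)
        - L / 2 * (e0 x \<bullet> e0 x) \<partial>M)"
    unfolding L2_inner_def by (simp add: ints del: inner_real_def times_divide_eq_left)
  also have "\<dots> \<le> (\<integral>x. \<tau> * (z x \<bullet> eu x) + L * ((e x - e0 x) \<bullet> e x) + es x \<bullet> e x \<partial>M)"
    by (intro integral_mono_AE pt Bochner_Integration.integrable_add Bochner_Integration.integrable_diff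
        integrable_mult_right ints)
  also have "\<dots> = \<tau> * L2_inner M z eu + L * L2_inner M (\<lambda>x. e x - e0 x) e + L2_inner M es e"
    unfolding L2_inner_def by (simp add: ints del: inner_real_def)
  \<comment> \<open>The mass equation trades the pressure terms for the divergence coupling; the
    flux equation then trades that for the interface terms.\<close>
  also have "\<dots> = \<tau> * L2_inner M z eu - \<tau> * L2_inner M e (\<lambda>x. dn x - d x)"
    using mass_err by linarith
  also have "\<dots> = - (\<tau> * (\<alpha> * L2_inner B (\<lambda>x. tn x - t x) (\<lambda>x. tn x - t x)
         + L2_inner B (\<lambda>x. gn x - g x) (\<lambda>x. tn x - t x)))"
    using arg_cong[OF err, of "\<lambda>y. \<tau> * y"] by (simp add: algebra_simps)
  finally show ?thesis
    unfolding L2_norm_power2 c_def eu_def es_def e_def e0_def by linarith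
qed

section \<open>The Robin exchange across the interface\<close>

text \<open>\<open>hn\<close> and \<open>h\<close> belong to one side of the interface, the other
  functions to the opposite side. The errors obey the same linear update weakly, so the identity is
  the expanded square of \<open>2 * \<alpha> * et + eg\<close>. The bracket is the interface term of
  \<open>subdomain_energy\<close>, which thereby becomes a difference of squared Robin
  errors.\<close>

lemma robin_exchange:
  fixes tn t gn g h hn :: "'d \<Rightarrow> real"
  assumes mem: "tn \<in> L2 B" "t \<in> L2 B" "gn \<in> L2 B" "g \<in> L2 B" "hn \<in> L2 B" "h \<in> L2 B"
    and n: "\<And>r. r \<in> L2 B \<Longrightarrow> L2_inner B hn r = L2_inner B (\<lambda>x. 2 * \<alpha> * tn x + gn x) r"
    and i: "\<And>r. r \<in> L2 B \<Longrightarrow> L2_inner B h r = L2_inner B (\<lambda>x. 2 * \<alpha> * t x + g x) r"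
  shows "(L2_norm B (\<lambda>x. hn x - h x))\<^sup>2 = (L2_norm B (\<lambda>x. gn x - g x))\<^sup>2
    + 4 * \<alpha> * (\<alpha> * L2_inner B (\<lambda>x. tn x - t x) (\<lambda>x. tn x - t x)
               + L2_inner B (\<lambda>x. gn x - g x) (\<lambda>x. tn x - t x))"
proof -
  define et where "et x = tn x - t x" for x
  define eg where "eg x = gn x - g x" for x
  have e: "et \<in> L2 B" "eg \<in> L2 B" "(\<lambda>x. 2 * \<alpha> * et x) \<in> L2 B"
    unfolding et_def[abs_def] eg_def[abs_def] using mem by (auto intro!: L2_diff L2_cmult)
  have w: "(\<lambda>x. 2 * \<alpha> * et x + eg x) \<in> L2 B"
    by (rule L2_add[OF e(3,2)])
  have W: "(\<lambda>x. 2 * \<alpha> * tn x + gn x) \<in> L2 B" "(\<lambda>x. 2 * \<alpha> * t x + g x) \<in> L2 B"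
    using mem by (auto intro!: L2_add L2_cmult)
  have eq: "(\<lambda>x. 2 * \<alpha> * et x + eg x) = (\<lambda>x. (2 * \<alpha> * tn x + gn x) - (2 * \<alpha> * t x + g x))"
    by (auto simp: et_def eg_def algebra_simps)
  have "L2_inner B (\<lambda>x. hn x - h x) (\<lambda>x. hn x - h x)
      = L2_inner B (\<lambda>x. 2 * \<alpha> * et x + eg x) (\<lambda>x. 2 * \<alpha> * et x + eg x)"
    using n i mem W w L2_diff[OF mem(5,6)] unfolding eq
    by (intro L2_inner_self_eqI) (simp_all only: L2_inner_diff_left)
  also have "\<dots> = 2 * \<alpha> * (2 * \<alpha> * L2_inner B et et + L2_inner B eg et)
      + (2 * \<alpha> * L2_inner B et eg + L2_inner B eg eg)"
    using e w
    by (simp only: L2_inner_add_left L2_inner_cmult_left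
        L2_inner_commute[of B et "\<lambda>x. 2 * \<alpha> * et x + eg x"]
        L2_inner_commute[of B eg "\<lambda>x. 2 * \<alpha> * et x + eg x"])
  finally show ?thesis
    unfolding L2_norm_power2 et_def eg_def
    by (simp add: L2_inner_commute[of B "\<lambda>x. tn x - t x" "\<lambda>x. gn x - g x"] algebra_simps)
qed

section \<open>Limits from summable decrements\<close>

text \<open>Telescoping bounds every partial sum of \<open>D\<close> by \<open>V 0\<close>, so
  \<open>D\<close> is summable.\<close>

lemma decrement_tendsto_zero:
  fixes V D :: "nat \<Rightarrow> real"
  assumes "\<And>i. 0 \<le> V i" "\<And>i. 0 \<le> D i" "\<And>i. V (Suc i) + D i \<le> V i"
  shows "D \<longlonglongrightarrow> 0"
proof -
  have sums: "(\<Sum>i<n. D i) + V n \<le> V 0" for n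
  proof (induction n)
    case (Suc n)
    then show ?case using assms(3)[of n] by simp
  qed simp
  have "(\<Sum>i<n. norm (D i)) \<le> V 0" for n
    using sums[of n] assms(1)[of n] by (simp add: assms(2))
  then have "summable D" by (intro summable_norm_cancel[OF summableI_nonneg_bounded]) auto
  then show ?thesis by (rule summable_LIMSEQ_zero)
qed

lemma tendsto_zero_of_scaled_bound:
  fixes f D :: "nat \<Rightarrow> real"
  assumes "c > 0" "\<And>i. 0 \<le> f i" "\<And>i. c * f i \<le> D i" "D \<longlonglongrightarrow> 0"
  shows "f \<longlonglongrightarrow> 0"
proof (rule tendsto_sandwich[OF _ _ tendsto_const])
  show "(\<lambda>i. D i / c) \<longlonglongrightarrow> 0" using tendsto_divide[OF assms(4) tendsto_const[of c]] assms(1) by simp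
  show "\<forall>\<^sub>F i in sequentially. f i \<le> D i / c"
    using assms by (intro always_eventually) (simp add: field_simps)
qed (use assms in auto)

section \<open>Assembly of the estimates on both subdomains\<close>

theorem theorem3p1:
  fixes \<Omega>0 D N :: "'a::euclidean_space set"
    and \<Omega> :: "2 \<Rightarrow> 'a set"
    and \<tau> \<alpha> :: real
    and L m\<^sub>k M\<^sub>k m\<^sub>k' M\<^sub>k' L\<^sub>k' L\<^sub>S M\<^sub>q :: "2 \<Rightarrow> real"
    and k S :: "2 \<Rightarrow> real \<Rightarrow> real"
    and F \<eta> :: "2 \<Rightarrow> 'a \<Rightarrow> real" and grad_\<eta> :: "2 \<Rightarrow> 'a \<Rightarrow> 'a"
    and p_prev :: "2 \<Rightarrow> 'a \<Rightarrow> real"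
    and qn :: "2 \<Rightarrow> 'a flux" and pn gn :: "2 \<Rightarrow> 'a \<Rightarrow> real"
    and q :: "nat \<Rightarrow> 2 \<Rightarrow> 'a flux" and p g :: "nat \<Rightarrow> 2 \<Rightarrow> 'a \<Rightarrow> real"
  assumes dim: "DIM('a) \<in> {2, 3}"
    and geometry: "two_domain_geometry \<Omega>0 \<Omega> D N"
    and tau: "\<tau> > 0"
    and F: "\<And>l. F l \<in> L2 (lebesgue_on (\<Omega> l))"
    and eta: "\<And>l. weak_gradient (\<Omega> l) (\<eta> l) (grad_\<eta> l)"
      "\<And>l. grad_\<eta> l \<in> L2 (lebesgue_on (\<Omega> l))"
    and p_prev: "p_prev \<in> P_space \<Omega>"
    and L_pos: "\<And>l. L l > 0"
    and k: "\<And>l. 0 < m\<^sub>k l" "\<And>l. m\<^sub>k l \<le> M\<^sub>k l" "\<And>l. k l ` {0..1} \<subseteq> {m\<^sub>k l..M\<^sub>k l}"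
      "\<And>l. \<exists>C. C-lipschitz_on {0..1} (k l)"
    and k_inv: "\<And>l. 0 < m\<^sub>k' l" "\<And>l. m\<^sub>k' l \<le> M\<^sub>k' l"
      "\<And>l. (\<lambda>s. 1 / k l s) ` {0..1} \<subseteq> {m\<^sub>k' l..M\<^sub>k' l}"
      "\<And>l. L\<^sub>k' l > 0" "\<And>l. (L\<^sub>k' l)-lipschitz_on {0..1} (\<lambda>s. 1 / k l s)"
    and S: "\<And>l. range (S l) \<subseteq> {0..1}" "\<And>l. mono (S l)"
      "\<And>l. L\<^sub>S l > 0" "\<And>l. (L\<^sub>S l)-lipschitz_on UNIV (S l)"
    and limit: "limit_problem \<Omega> N \<tau> \<alpha> k S F grad_\<eta> p_prev qn pn gn"
    and flux_bound: "\<And>l. M\<^sub>q l > 0"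
      "\<And>l. Linf_norm (lebesgue_on (\<Omega> l)) (vfield (qn l)) \<le> ereal (M\<^sub>q l)"
    and start: "q 0 \<in> Q_space \<Omega> N" "p 0 \<in> P_space \<Omega>" "g 0 \<in> G_space \<Omega>"
    and scheme: "\<And>i. iteration_step \<Omega> N \<tau> \<alpha> L k S F grad_\<eta> p_prev
                   (q i) (p i) (g i) (q (Suc i)) (p (Suc i)) (g (Suc i))"
    and a: "\<And>l. L l > L\<^sub>S l / 2"
    and b: "\<alpha> > 0"
    and c: "\<And>l. \<tau> < (1 / L\<^sub>S l - 1 / (2 * L l)) * (2 * m\<^sub>k' l / ((L\<^sub>k' l)\<^sup>2 * (M\<^sub>q l)\<^sup>2))"
  shows "(\<lambda>i. pair_norm \<Omega> (\<lambda>l x. vfield (qn l) x - vfield (q i l) x)) \<longlonglongrightarrow> 0 \<and>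
         (\<lambda>i. pair_norm \<Omega> (\<lambda>l x. S l (pn l x) - S l (p i l x))) \<longlonglongrightarrow> 0"
proof -
  define G where "G = surface_on (interface \<Omega>)"
  define M where "M l = lebesgue_on (\<Omega> l)" for l
  \<comment> \<open>Finite measure makes the saturations, with values in \<open>{0..1}\<close>,
    square-integrable.\<close>
  have fin: "finite_measure (M l)" for l
  proof -
    have "open (\<Omega> l)" "bounded (\<Omega> l)"
      using geometry by (auto simp: two_domain_geometry_def lipschitz_domain_def)
    then have "\<Omega> l \<in> lmeasurable" by (simp add: lmeasurable_open)
    then show ?thesis unfolding M_def by (rule finite_measure_lebesgue_on)
  qed
  note [simp] = M_def[symmetric] G_def[symmetric]
  have qn: "vfield (qn l) \<in> L2 (M l)" "divg (qn l) \<in> L2 (M l)" "ntrace (qn l) \<in> L2 G" for l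
    using limit by (auto simp: limit_problem_def Q_space_def Q_sub_def)
  \<comment> \<open>Iterate \<open>Suc j\<close> lies in the spaces by step \<open>j\<close> of the
    scheme. For \<open>i = 0\<close>, where \<open>i - 1\<close> is again \<open>0\<close>,
    \<open>start\<close> applies.\<close>
  have qi: "q i \<in> Q_space \<Omega> N" "p i \<in> P_space \<Omega>" "g i \<in> G_space \<Omega>" for i
    using start scheme[of "i - 1"] by (cases i; simp add: iteration_step_def)+
  have q: "vfield (q i l) \<in> L2 (M l)" "divg (q i l) \<in> L2 (M l)" "ntrace (q i l) \<in> L2 G" for i l
    using qi(1)[of i] by (auto simp: Q_space_def Q_sub_def)
  have p: "p i l \<in> L2 (M l)" and g: "g i l \<in> L2 G" for i l
    using qi(2,3)[of i] by (auto simp: P_space_def G_space_def)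
  have pn: "pn l \<in> L2 (M l)" and gn: "gn l \<in> L2 G" and pp: "p_prev l \<in> L2 (M l)" for l
    using limit p_prev by (auto simp: limit_problem_def P_space_def G_space_def)
  have bd: "AE x in M l. norm (vfield (qn l) x) \<le> M\<^sub>q l" for l
    using esssup_AE[of "\<lambda>x. ereal (norm (vfield (qn l) x))" "M l"]
  proof eventually_elim
    case (elim x)
    then have "ereal (norm (vfield (qn l) x)) \<le> ereal (M\<^sub>q l)"
      using flux_bound(2)[of l] unfolding Linf_norm_def M_def by (rule order_trans)
    then show ?case by simp
  qed
  define c where "c l = 1 / L\<^sub>S l - 1 / (2 * L l) - \<tau> * (L\<^sub>k' l)\<^sup>2 * (M\<^sub>q l)\<^sup>2 / (2 * m\<^sub>k' l)" for l
  define W where "W i l = \<alpha> * L2_inner G (\<lambda>x. ntrace (qn l) x - ntrace (q i l) x)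
      (\<lambda>x. ntrace (qn l) x - ntrace (q i l) x)
    + L2_inner G (\<lambda>x. gn l x - g i l x) (\<lambda>x. ntrace (qn l) x - ntrace (q i l) x)" for i l
  define eq where "eq i l = (L2_norm (M l) (\<lambda>x. vfield (qn l) x - vfield (q i l) x))\<^sup>2" for i l
  define es where "es i l = (L2_norm (M l) (\<lambda>x. S l (pn l x) - S l (p i l x)))\<^sup>2" for i l
  define ep where "ep i l = (L2_norm (M l) (\<lambda>x. pn l x - p i l x))\<^sup>2" for i l
  define eg where "eg i l = (L2_norm G (\<lambda>x. gn l x - g i l x))\<^sup>2" for i l
  \<comment> \<open>This is the time step restriction rearranged: its last factor is the reciprocal
    of the Young loss in the definition of \<open>c\<close>.\<close>
  have cpos: "c l > 0" for l
  proof -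
    have "\<tau> * ((L\<^sub>k' l)\<^sup>2 * (M\<^sub>q l)\<^sup>2 / (2 * m\<^sub>k' l)) < 1 / L\<^sub>S l - 1 / (2 * L l)"
      using c[of l] k_inv(1,4)[of l] flux_bound(1)[of l] by (simp add: field_simps)
    then show ?thesis unfolding c_def by (simp add: mult.assoc)
  qed
  have step: "\<tau> * m\<^sub>k' l / 2 * eq (Suc i) l + c l * es i l + L l / 2 * ep (Suc i) l + \<tau> * W (Suc i) l
      \<le> L l / 2 * ep i l" for i l
    unfolding eq_def es_def ep_def W_def c_def
  proof (rule subdomain_energy[where \<kappa> = "\<lambda>s. 1 / k l s" and m' = "M\<^sub>k' l" and w = "grad_\<eta> l"
        and F = "F l" and dn = "divg (qn l)" and d = "divg (q (Suc i) l)" and pp = "p_prev l"])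
    have "qn \<in> Q_space \<Omega> N" using limit by (simp add: limit_problem_def)
    note test = this qi(1)[of "Suc i"]
    have "flux_equation \<Omega> \<alpha> k S grad_\<eta> pn qn pn gn v l" if "v \<in> {qn, q (Suc i)}" for v
      using limit test that by (auto simp: limit_problem_def)
    from this[of qn] this[of "q (Suc i)"]
    show "L2_inner (M l) (\<lambda>x. (1 / k l (S l (pn l x))) *\<^sub>R vfield (qn l) x) v - L2_inner (M l) (pn l) dv
        + \<alpha> * L2_inner G (ntrace (qn l)) tv = L2_inner (M l) (grad_\<eta> l) v - L2_inner G (gn l) tv"
      if "(v, dv, tv) \<in> {(vfield (qn l), divg (qn l), ntrace (qn l)),
        (vfield (q (Suc i) l), divg (q (Suc i) l), ntrace (q (Suc i) l))}" for v dv tv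
      using that by (auto simp: flux_equation_def)
    have "flux_equation \<Omega> \<alpha> k S grad_\<eta> (p i) (q (Suc i)) (p (Suc i)) (g (Suc i)) v l"
      if "v \<in> {qn, q (Suc i)}" for v
      using scheme[of i] test that by (auto simp: iteration_step_def)
    from this[of qn] this[of "q (Suc i)"]
    show "L2_inner (M l) (\<lambda>x. (1 / k l (S l (p i l x))) *\<^sub>R vfield (q (Suc i) l) x) v
        - L2_inner (M l) (p (Suc i) l) dv + \<alpha> * L2_inner G (ntrace (q (Suc i) l)) tv
        = L2_inner (M l) (grad_\<eta> l) v - L2_inner G (g (Suc i) l) tv"
      if "(v, dv, tv) \<in> {(vfield (qn l), divg (qn l), ntrace (qn l)),
        (vfield (q (Suc i) l), divg (q (Suc i) l), ntrace (q (Suc i) l))}" for v dv tv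
      using that by (auto simp: flux_equation_def)
    fix r :: "'a \<Rightarrow> real" assume r: "r \<in> L2 (M l)"
    \<comment> \<open>The mass equations are tested with pairs, so \<open>r\<close> is extended by
      zero to the other subdomain.\<close>
    define r' where "r' j = (if j = l then r else (\<lambda>_. 0))" for j
    have r': "r' \<in> P_space \<Omega>" "r' l = r"
      using r by (auto simp: P_space_def r'_def) (simp add: L2_def)
    show "L2_inner (M l) (\<lambda>x. S l (pn l x)) r + \<tau> * L2_inner (M l) (divg (qn l)) r
        = \<tau> * L2_inner (M l) (F l) r + L2_inner (M l) (\<lambda>x. S l (p_prev l x)) r"
      using limit r' by (auto simp: limit_problem_def)
    show "L l * L2_inner (M l) (p (Suc i) l) r + \<tau> * L2_inner (M l) (divg (q (Suc i) l)) r
        = \<tau> * L2_inner (M l) (F l) r - L2_inner (M l) (\<lambda>x. S l (p i l x) - S l (p_prev l x)) r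
          + L l * L2_inner (M l) (p i l) r"
      using scheme[of i] r' by (auto simp: iteration_step_def)
  qed (use fin qn q p pn g gn pp bd k_inv S tau L_pos in auto)
  have robin: "eg (Suc i) l = eg i j + 4 * \<alpha> * W i j" if "l \<noteq> j" for i l j
    unfolding eg_def W_def
  proof (rule robin_exchange)
    fix r :: "'a \<Rightarrow> real" assume "r \<in> L2 G"
    \<comment> \<open>Both components live on the same interface, so the constant pair is
      admissible.\<close>
    then have r: "(\<lambda>_. r) \<in> G_space \<Omega>" by (simp add: G_space_def)
    show "L2_inner G (gn l) r = L2_inner G (\<lambda>x. 2 * \<alpha> * ntrace (qn j) x + gn j x) r"
      using limit r that by (auto simp: limit_problem_def robin_equation_def)
    show "L2_inner G (g (Suc i) l) r = L2_inner G (\<lambda>x. 2 * \<alpha> * ntrace (q i j) x + g i j x) r"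
      using scheme[of i] r that by (auto simp: iteration_step_def robin_equation_def)
  qed (use qn q g gn in auto)
  \<comment> \<open>The Robin datum at \<open>Suc i\<close> is computed from iterate
    \<open>i\<close> and enters the next flux equation. The weight
    \<open>\<tau> / (4 * \<alpha>)\<close> turns the increment in \<open>robin\<close> into the term
    \<open>\<tau> * W\<close> of \<open>step\<close>.\<close>
  define V where "V i = (\<Sum>l\<in>UNIV. L l / 2 * ep i l) + \<tau> / (4 * \<alpha>) * (\<Sum>l\<in>UNIV. eg (Suc i) l)" for i
  define D where "D i = (\<Sum>l\<in>UNIV. \<tau> * m\<^sub>k' l / 2 * eq (Suc i) l + c l * es i l)" for i
  have nn: "eq i l \<ge> 0" "es i l \<ge> 0" "ep i l \<ge> 0" "eg i l \<ge> 0" for i l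
    by (auto simp: eq_def es_def ep_def eg_def)
  have "D \<longlonglongrightarrow> 0"
  proof (rule decrement_tendsto_zero[of V])
    show "V i \<ge> 0" "D i \<ge> 0" for i
      unfolding V_def D_def using nn L_pos tau b cpos k_inv(1)
      by (auto intro!: add_nonneg_nonneg sum_nonneg mult_nonneg_nonneg divide_nonneg_nonneg simp: less_imp_le)
    show "V (Suc i) + D i \<le> V i" for i
    proof -
      \<comment> \<open>The exchange swaps the two subdomains, which leaves the sum over both
        unchanged.\<close>
      have "\<tau> / (4 * \<alpha>) * (\<Sum>l\<in>UNIV. eg (Suc (Suc i)) l)
          = \<tau> / (4 * \<alpha>) * (\<Sum>l\<in>UNIV. eg (Suc i) l) + \<tau> * (\<Sum>l\<in>UNIV. W (Suc i) l)"
        using robin[of 1 2 "Suc i"] robin[of 2 1 "Suc i"] b by (simp add: sum_2 field_simps)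
      moreover have "D i + (\<Sum>l\<in>UNIV. L l / 2 * ep (Suc i) l) + \<tau> * (\<Sum>l\<in>UNIV. W (Suc i) l)
          \<le> (\<Sum>l\<in>UNIV. L l / 2 * ep i l)"
        unfolding D_def sum_distrib_left sum.distrib[symmetric] by (intro sum_mono step)
      ultimately show ?thesis unfolding V_def by linarith
    qed
  qed
  \<comment> \<open>All summands of \<open>D i\<close> are nonnegative, so each one is bounded by
    the total.\<close>
  have Dq: "\<tau> * m\<^sub>k' l / 2 * eq (Suc i) l \<le> D i" and DS: "c l * es i l \<le> D i" for i l
  proof -
    have pos: "0 \<le> \<tau> * m\<^sub>k' j / 2 * eq (Suc i) j" "0 \<le> c j * es i j" for j
      using nn tau k_inv(1)[of j] cpos[of j] by (auto simp: less_imp_le)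
    have "\<tau> * m\<^sub>k' l / 2 * eq (Suc i) l + c l * es i l \<le> D i"
      unfolding D_def
      by (rule member_le_sum[where f = "\<lambda>l. \<tau> * m\<^sub>k' l / 2 * eq (Suc i) l + c l * es i l"])
         (use pos in \<open>auto intro: add_nonneg_nonneg\<close>)
    then show "\<tau> * m\<^sub>k' l / 2 * eq (Suc i) l \<le> D i" "c l * es i l \<le> D i"
      using pos[of l] by linarith+
  qed
  have "(\<lambda>i. eq (Suc i) l) \<longlonglongrightarrow> 0" for l
    by (rule tendsto_zero_of_scaled_bound[OF _ nn(1) Dq \<open>D \<longlonglongrightarrow> 0\<close>]) (use tau k_inv(1)[of l] in simp)
  \<comment> \<open>\<open>D i\<close> controls the flux error of iterate \<open>Suc i\<close>; the
    shift does not affect the limit.\<close>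
  then have "(\<lambda>i. eq i l) \<longlonglongrightarrow> 0" for l by (rule LIMSEQ_imp_Suc)
  then have "(\<lambda>i. sqrt (\<Sum>l\<in>UNIV. eq i l)) \<longlonglongrightarrow> sqrt (\<Sum>l\<in>(UNIV :: 2 set). 0)"
    by (intro tendsto_real_sqrt tendsto_sum)
  moreover have "(\<lambda>i. es i l) \<longlonglongrightarrow> 0" for l
    by (rule tendsto_zero_of_scaled_bound[OF cpos nn(2) DS \<open>D \<longlonglongrightarrow> 0\<close>])
  then have "(\<lambda>i. sqrt (\<Sum>l\<in>UNIV. es i l)) \<longlonglongrightarrow> sqrt (\<Sum>l\<in>(UNIV :: 2 set). 0)"
    by (intro tendsto_real_sqrt tendsto_sum)
  ultimately show ?thesis
    by (simp add: pair_norm_def eq_def es_def)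
qed

end
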